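(* Let $G$ be a completely metrizable topological group, let $(\Gamma_a)_{a\in A}$ be a family of non-trivial groups, and let $\Gamma=\mathop{*}_{a\in A}\Gamma_a$ be their free product, equipped with the discrete topology. Let $\phi:G\to\Gamma$ be a group homomorphism. Then $\phi$ is continuous unless the image of $\phi$ is contained in a factor of $\Gamma$. That is, either $\phi$ is continuous, or there are $a\in A$ and $\gamma\in\Gamma$ such that $\phi(G)\subseteq\gamma\Gamma_a\gamma^{-1}$.
   Context: $\mathop{*}_{a\in A}\Gamma_a$ denotes the free product of the groups $\Gamma_a$, each $\Gamma_a$ being viewed as a subgroup of the free product. A topological group is completely metrizable if its topology is induced by some complete metric. The homomorphism $\phi$ is not assumed to be continuous. The image of $\phi$ is said to be contained in a factor of $\Gamma$ if there are $a\in A$ and $\gamma\in\Gamma$ with $\phi(G)\subseteq\gamma\Gamma_a\gamma^{-1}$. *)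

theory Defs
  imports "HOL-Analysis.Analysis" "HOL-Algebra.Algebra"
begin

locale topological_group = group G for G (structure) +
  fixes T :: "'a topology"
  assumes topspace_eq_carrier: "topspace T = carrier G"
    and continuous_mult: "continuous_map (prod_topology T T) T (\<lambda>(x, y). x \<otimes> y)"
    and continuous_inv: "continuous_map T T (\<lambda>x. inv x)"

text \<open>
  The free product of the groups \<open>\<Gamma> a\<close> with \<open>a \<in> A\<close>, realised on reduced words: lists of
  pairs (index, non-trivial element of the factor with that index) in which neighbouring indices
  are distinct. Words are multiplied by prepending the letters of the left word one at a time,
  reducing at each step.
\<close>

definition reduced_words :: "'i set \<Rightarrow> ('i \<Rightarrow> ('g, 'm) monoid_scheme) \<Rightarrow> ('i \<times> 'g) list set" where
  "reduced_words A \<Gamma> =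
    {w. (\<forall>(a, g) \<in> set w. a \<in> A \<and> g \<in> carrier (\<Gamma> a) \<and> g \<noteq> \<one>\<^bsub>\<Gamma> a\<^esub>) \<and> distinct_adj (map fst w)}"

fun cons_reduce ::
    "('i \<Rightarrow> ('g, 'm) monoid_scheme) \<Rightarrow> 'i \<times> 'g \<Rightarrow> ('i \<times> 'g) list \<Rightarrow> ('i \<times> 'g) list" where
  "cons_reduce \<Gamma> (a, g) [] = (if g = \<one>\<^bsub>\<Gamma> a\<^esub> then [] else [(a, g)])"
| "cons_reduce \<Gamma> (a, g) ((b, h) # w) =
    (if g = \<one>\<^bsub>\<Gamma> a\<^esub> then (b, h) # w
     else if a \<noteq> b then (a, g) # (b, h) # w
     else if g \<otimes>\<^bsub>\<Gamma> a\<^esub> h = \<one>\<^bsub>\<Gamma> a\<^esub> then w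
     else (a, g \<otimes>\<^bsub>\<Gamma> a\<^esub> h) # w)"

definition free_product ::
    "'i set \<Rightarrow> ('i \<Rightarrow> ('g, 'm) monoid_scheme) \<Rightarrow> ('i \<times> 'g) list monoid" where
  "free_product A \<Gamma> =
    \<lparr>carrier = reduced_words A \<Gamma>, mult = (\<lambda>u v. foldr (cons_reduce \<Gamma>) u v), one = []\<rparr>"

definition factor_incl :: "('i \<Rightarrow> ('g, 'm) monoid_scheme) \<Rightarrow> 'i \<Rightarrow> 'g \<Rightarrow> ('i \<times> 'g) list" where
  "factor_incl \<Gamma> a g = (if g = \<one>\<^bsub>\<Gamma> a\<^esub> then [] else [(a, g)])"

text \<open>The group \<open>\<Gamma> a\<close>, viewed as a subgroup of the free product.\<close>

definition free_factor :: "('i \<Rightarrow> ('g, 'm) monoid_scheme) \<Rightarrow> 'i \<Rightarrow> ('i \<times> 'g) list set" where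
  "free_factor \<Gamma> a = factor_incl \<Gamma> a ` carrier (\<Gamma> a)"

text \<open>
  The construction does give a group containing each \<open>\<Gamma> a\<close>, with the universal property of the
  free product.
\<close>

lemma reduced_words_Nil [simp]: "[] \<in> reduced_words A \<Gamma>"
  by (simp add: reduced_words_def)

lemma reduced_words_Cons:
  "(a, g) # w \<in> reduced_words A \<Gamma> \<longleftrightarrow>
    a \<in> A \<and> g \<in> carrier (\<Gamma> a) \<and> g \<noteq> \<one>\<^bsub>\<Gamma> a\<^esub> \<and> w \<in> reduced_words A \<Gamma> \<and>
    (w = [] \<or> fst (hd w) \<noteq> a)"
  by (cases w) (auto simp: reduced_words_def)

lemma cons_reduce_reduced [simp]:
  "(a, g) # w \<in> reduced_words A \<Gamma> \<Longrightarrow> cons_reduce \<Gamma> (a, g) w = (a, g) # w"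
  by (cases w) (auto simp: reduced_words_Cons)

lemma cons_reduce_one [simp]: "cons_reduce \<Gamma> (a, \<one>\<^bsub>\<Gamma> a\<^esub>) w = w"
  by (cases w) auto

lemma cons_reduce_closed:
  assumes "\<And>a. a \<in> A \<Longrightarrow> group (\<Gamma> a)" "a \<in> A" "g \<in> carrier (\<Gamma> a)" "w \<in> reduced_words A \<Gamma>"
  shows "cons_reduce \<Gamma> (a, g) w \<in> reduced_words A \<Gamma>"
proof -
  interpret group "\<Gamma> a" using assms by blast
  show ?thesis using assms(2-) by (cases w) (auto simp: reduced_words_Cons)
qed

lemma cons_reduce_cons_reduce:
  assumes "\<And>a. a \<in> A \<Longrightarrow> group (\<Gamma> a)" "a \<in> A" "g \<in> carrier (\<Gamma> a)" "h \<in> carrier (\<Gamma> a)"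
    "w \<in> reduced_words A \<Gamma>"
  shows "cons_reduce \<Gamma> (a, g) (cons_reduce \<Gamma> (a, h) w) = cons_reduce \<Gamma> (a, g \<otimes>\<^bsub>\<Gamma> a\<^esub> h) w"
proof -
  interpret group "\<Gamma> a" using assms by blast
  show ?thesis
  proof (cases "\<exists>k w'. w = (a, k) # w'")
    case True
    then obtain k w' where w: "w = (a, k) # w'" by blast
    have k: "k \<in> carrier (\<Gamma> a)" "k \<noteq> \<one>\<^bsub>\<Gamma> a\<^esub>" "w' = [] \<or> fst (hd w') \<noteq> a"
      using assms(5) by (auto simp: w reduced_words_Cons)
    have simple: "cons_reduce \<Gamma> (a, x) w' = (if x = \<one>\<^bsub>\<Gamma> a\<^esub> then w' else (a, x) # w')" for x
      using k(3) by (cases w') auto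
    have gen: "cons_reduce \<Gamma> (a, x) w = cons_reduce \<Gamma> (a, x \<otimes>\<^bsub>\<Gamma> a\<^esub> k) w'"
      if "x \<in> carrier (\<Gamma> a)" for x
      using that k by (auto simp: w simple)
    have gen2: "cons_reduce \<Gamma> (a, x) (cons_reduce \<Gamma> (a, y) w') = cons_reduce \<Gamma> (a, x \<otimes>\<^bsub>\<Gamma> a\<^esub> y) w'"
      if "x \<in> carrier (\<Gamma> a)" "y \<in> carrier (\<Gamma> a)" for x y
      using that by (auto simp: simple)
    show ?thesis using assms(3,4) k(1) by (simp add: gen gen2 m_assoc)
  next
    case False
    then have simple: "cons_reduce \<Gamma> (a, x) w = (if x = \<one>\<^bsub>\<Gamma> a\<^esub> then w else (a, x) # w)" for x
      by (cases w) auto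
    show ?thesis using assms(3,4) by (auto simp: simple)
  qed
qed

lemma free_product_mult_closed:
  assumes "\<And>a. a \<in> A \<Longrightarrow> group (\<Gamma> a)" "u \<in> reduced_words A \<Gamma>" "v \<in> reduced_words A \<Gamma>"
  shows "foldr (cons_reduce \<Gamma>) u v \<in> reduced_words A \<Gamma>"
  using assms(2)
  by (induction u) (auto simp: reduced_words_Cons assms intro!: cons_reduce_closed)

lemma foldr_cons_reduce:
  assumes "\<And>a. a \<in> A \<Longrightarrow> group (\<Gamma> a)" "a \<in> A" "g \<in> carrier (\<Gamma> a)"
    "u \<in> reduced_words A \<Gamma>" "v \<in> reduced_words A \<Gamma>"
  shows "foldr (cons_reduce \<Gamma>) (cons_reduce \<Gamma> (a, g) u) v
    = cons_reduce \<Gamma> (a, g) (foldr (cons_reduce \<Gamma>) u v)"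
proof (cases "\<exists>h u'. u = (a, h) # u'")
  case True
  then obtain h u' where u: "u = (a, h) # u'" by blast
  have h: "h \<in> carrier (\<Gamma> a)" "u' \<in> reduced_words A \<Gamma>"
    using assms(4) by (auto simp: u reduced_words_Cons)
  have *: "foldr (cons_reduce \<Gamma>) u' v \<in> reduced_words A \<Gamma>"
    using free_product_mult_closed assms(1) h(2) assms(5) by blast
  show ?thesis
    using cons_reduce_cons_reduce[OF assms(1) assms(2,3) h(1) *] by (auto simp: u)
next
  case False
  then show ?thesis by (cases u) auto
qed

lemma free_product_mult_assoc:
  assumes "\<And>a. a \<in> A \<Longrightarrow> group (\<Gamma> a)"
    "u \<in> reduced_words A \<Gamma>" "v \<in> reduced_words A \<Gamma>" "w \<in> reduced_words A \<Gamma>"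
  shows "foldr (cons_reduce \<Gamma>) (foldr (cons_reduce \<Gamma>) u v) w
    = foldr (cons_reduce \<Gamma>) u (foldr (cons_reduce \<Gamma>) v w)"
  using assms(2)
proof (induction u)
  case (Cons x u)
  obtain a g where x: "x = (a, g)" by force
  have xu: "a \<in> A" "g \<in> carrier (\<Gamma> a)" "u \<in> reduced_words A \<Gamma>"
    using Cons.prems by (auto simp: x reduced_words_Cons)
  have uv: "foldr (cons_reduce \<Gamma>) u v \<in> reduced_words A \<Gamma>"
    using free_product_mult_closed assms(1) xu(3) assms(3) by blast
  show ?case
    using foldr_cons_reduce[OF assms(1) xu(1,2) uv assms(4)] Cons.IH[OF xu(3)] by (simp add: x)
qed simp

lemma free_product_group:
  assumes "\<And>a. a \<in> A \<Longrightarrow> group (\<Gamma> a)"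
  shows "group (free_product A \<Gamma>)"
proof (rule groupI)
  fix u v w
  assume "u \<in> carrier (free_product A \<Gamma>)" "v \<in> carrier (free_product A \<Gamma>)"
    "w \<in> carrier (free_product A \<Gamma>)"
  then show "u \<otimes>\<^bsub>free_product A \<Gamma>\<^esub> v \<otimes>\<^bsub>free_product A \<Gamma>\<^esub> w
    = u \<otimes>\<^bsub>free_product A \<Gamma>\<^esub> (v \<otimes>\<^bsub>free_product A \<Gamma>\<^esub> w)"
    using free_product_mult_assoc[OF assms] by (simp add: free_product_def)
next
  fix u assume "u \<in> carrier (free_product A \<Gamma>)"
  then have "u \<in> reduced_words A \<Gamma>" by (simp add: free_product_def)
  then have "\<exists>v \<in> reduced_words A \<Gamma>. foldr (cons_reduce \<Gamma>) v u = []"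
  proof (induction u)
    case (Cons x u)
    obtain a g where x: "x = (a, g)" by force
    have xu: "a \<in> A" "g \<in> carrier (\<Gamma> a)" "u \<in> reduced_words A \<Gamma>"
      using Cons.prems by (auto simp: x reduced_words_Cons)
    interpret a: group "\<Gamma> a" using assms xu by blast
    obtain v where v: "v \<in> reduced_words A \<Gamma>" "foldr (cons_reduce \<Gamma>) v u = []"
      using Cons.IH xu by blast
    let ?y = "cons_reduce \<Gamma> (a, inv\<^bsub>\<Gamma> a\<^esub> g) []"
    have y: "?y \<in> reduced_words A \<Gamma>"
      by (rule cons_reduce_closed[OF assms xu(1) a.inv_closed[OF xu(2)] reduced_words_Nil[of A \<Gamma>]])
    have "foldr (cons_reduce \<Gamma>) ?y (x # u) = cons_reduce \<Gamma> (a, inv\<^bsub>\<Gamma> a\<^esub> g) (x # u)"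
      using foldr_cons_reduce[OF assms xu(1) a.inv_closed[OF xu(2)] reduced_words_Nil[of A \<Gamma>] Cons.prems]
      by simp
    moreover have "x # u = cons_reduce \<Gamma> (a, g) u"
      using Cons.prems by (simp add: x)
    moreover have "cons_reduce \<Gamma> (a, inv\<^bsub>\<Gamma> a\<^esub> g) (cons_reduce \<Gamma> (a, g) u) = u"
      using cons_reduce_cons_reduce[OF assms xu(1) a.inv_closed[OF xu(2)] xu(2,3)] xu(2) by simp
    ultimately have yx: "foldr (cons_reduce \<Gamma>) ?y (x # u) = u"
      by (metis (no_types))
    have "foldr (cons_reduce \<Gamma>) (foldr (cons_reduce \<Gamma>) v ?y) (x # u) = []"
      by (subst free_product_mult_assoc[where A = A and \<Gamma> = \<Gamma>])
        (use assms v y yx Cons.prems in \<open>simp_all only:\<close>)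
    then show ?case
      using free_product_mult_closed[OF assms v(1) y] by blast
  qed (auto intro!: bexI[where x = "[]"])
  then show "\<exists>v \<in> carrier (free_product A \<Gamma>). v \<otimes>\<^bsub>free_product A \<Gamma>\<^esub> u = \<one>\<^bsub>free_product A \<Gamma>\<^esub>"
    by (simp add: free_product_def)
qed (use free_product_mult_closed[OF assms] in \<open>auto simp: free_product_def\<close>)

lemma factor_incl_hom:
  assumes "group (\<Gamma> a)" "a \<in> A"
  shows "factor_incl \<Gamma> a \<in> hom (\<Gamma> a) (free_product A \<Gamma>)"
proof -
  interpret group "\<Gamma> a" by fact
  show ?thesis
    using assms(2)
    by (auto simp: hom_def factor_incl_def free_product_def reduced_words_Cons)
qed

lemma inj_factor_incl: "inj (factor_incl \<Gamma> a)"
  by (auto simp: inj_def factor_incl_def)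

lemma free_product_universal:
  assumes "\<And>a. a \<in> A \<Longrightarrow> group (\<Gamma> a)" "group H" "\<And>a. a \<in> A \<Longrightarrow> f a \<in> hom (\<Gamma> a) H"
  shows "\<exists>F \<in> hom (free_product A \<Gamma>) H. \<forall>a\<in>A. \<forall>g\<in>carrier (\<Gamma> a). F (factor_incl \<Gamma> a g) = f a g"
proof -
  interpret H: group H by fact
  define F where "F w = foldr (\<lambda>(a, g) y. f a g \<otimes>\<^bsub>H\<^esub> y) w \<one>\<^bsub>H\<^esub>" for w
  have F_simps: "F [] = \<one>\<^bsub>H\<^esub>" "F ((a, g) # w) = f a g \<otimes>\<^bsub>H\<^esub> F w" for a g w
    by (auto simp: F_def)
  have fc: "f a g \<in> carrier H" if "a \<in> A" "g \<in> carrier (\<Gamma> a)" for a g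
    using assms(3) that by (auto simp: hom_def)
  have f1: "f a \<one>\<^bsub>\<Gamma> a\<^esub> = \<one>\<^bsub>H\<^esub>" if "a \<in> A" for a
    using hom_one[OF assms(3)[OF that] assms(1)[OF that] assms(2)] .
  have fm: "f a (g \<otimes>\<^bsub>\<Gamma> a\<^esub> h) = f a g \<otimes>\<^bsub>H\<^esub> f a h"
    if "a \<in> A" "g \<in> carrier (\<Gamma> a)" "h \<in> carrier (\<Gamma> a)" for a g h
    using assms(3) that by (auto simp: hom_def)
  have Fc: "F w \<in> carrier H" if "w \<in> reduced_words A \<Gamma>" for w
    using that by (induction w) (auto simp: F_simps reduced_words_Cons fc)
  have Fcons: "F (cons_reduce \<Gamma> (a, g) w) = f a g \<otimes>\<^bsub>H\<^esub> F w"
    if "a \<in> A" "g \<in> carrier (\<Gamma> a)" "w \<in> reduced_words A \<Gamma>" for a g w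
  proof (cases w)
    case Nil
    then show ?thesis using that by (auto simp: F_simps f1 fc)
  next
    case (Cons x w')
    obtain b h where x: "x = (b, h)" by force
    have h: "b \<in> A" "h \<in> carrier (\<Gamma> b)" "w' \<in> reduced_words A \<Gamma>"
      using that(3) by (auto simp: Cons x reduced_words_Cons)
    have "f a g \<otimes>\<^bsub>H\<^esub> (f a h \<otimes>\<^bsub>H\<^esub> F w') = F w'"
      if "a = b" "g \<otimes>\<^bsub>\<Gamma> a\<^esub> h = \<one>\<^bsub>\<Gamma> a\<^esub>"
      using fm[of a g h] that h f1[of a] \<open>g \<in> carrier (\<Gamma> a)\<close> fc Fc
      by (simp flip: H.m_assoc)
    then show ?thesis
      using that h by (auto simp: Cons x F_simps f1 fc fm Fc H.m_assoc)
  qed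
  have "F (foldr (cons_reduce \<Gamma>) u v) = F u \<otimes>\<^bsub>H\<^esub> F v"
    if "u \<in> reduced_words A \<Gamma>" "v \<in> reduced_words A \<Gamma>" for u v
    using that(1)
    by (induction u)
      (auto simp: F_simps reduced_words_Cons Fc fc Fcons H.m_assoc that(2)
        free_product_mult_closed[OF assms(1)])
  then have "F \<in> hom (free_product A \<Gamma>) H"
    by (auto simp: hom_def free_product_def Fc)
  moreover have "\<forall>a\<in>A. \<forall>g\<in>carrier (\<Gamma> a). F (factor_incl \<Gamma> a g) = f a g"
    by (auto simp: factor_incl_def F_simps f1 fc)
  ultimately show ?thesis by blast
qed

lemma free_product_universal_unique:
  assumes "\<And>a. a \<in> A \<Longrightarrow> group (\<Gamma> a)" "group H"
    "F \<in> hom (free_product A \<Gamma>) H" "F' \<in> hom (free_product A \<Gamma>) H"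
    "\<And>a g. a \<in> A \<Longrightarrow> g \<in> carrier (\<Gamma> a) \<Longrightarrow> F (factor_incl \<Gamma> a g) = F' (factor_incl \<Gamma> a g)"
    "w \<in> carrier (free_product A \<Gamma>)"
  shows "F w = F' w"
proof -
  have "w \<in> reduced_words A \<Gamma>" using assms(6) by (simp add: free_product_def)
  then show ?thesis
  proof (induction w)
    case Nil
    show ?case
      using hom_one[OF assms(3) free_product_group[OF assms(1)] assms(2)]
        hom_one[OF assms(4) free_product_group[OF assms(1)] assms(2)]
      by (simp add: free_product_def)
  next
    case (Cons x w)
    obtain a g where x: "x = (a, g)" by force
    have xw: "a \<in> A" "g \<in> carrier (\<Gamma> a)" "g \<noteq> \<one>\<^bsub>\<Gamma> a\<^esub>" "w \<in> reduced_words A \<Gamma>"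
      using Cons.prems by (auto simp: x reduced_words_Cons)
    have split: "x # w = factor_incl \<Gamma> a g \<otimes>\<^bsub>free_product A \<Gamma>\<^esub> w"
      using xw Cons.prems by (simp add: x factor_incl_def free_product_def)
    have c: "factor_incl \<Gamma> a g \<in> carrier (free_product A \<Gamma>)" "w \<in> carrier (free_product A \<Gamma>)"
      using xw by (auto simp: free_product_def factor_incl_def reduced_words_Cons)
    show ?case
      unfolding split hom_mult[OF assms(3) c] hom_mult[OF assms(4) c]
      using Cons.IH xw assms(5) by simp
  qed
qed

end

theory Submission
  imports Defs
begin

text \<open>
  The free product \<open>\<Gamma>\<close> acts on its Bass--Serre tree. An element is either hyperbolic, that is, it
  translates along an axis, or elliptic, that is, it fixes a vertex; a non-trivial element fixes at most one vertex,
  and its fixed vertex is a coset of a factor. All of this is read off the word length, which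
  satisfies the ultrametric inequality characteristic of actions on trees. The proof splits
  according to whether arbitrarily small elements of \<open>G\<close> have hyperbolic images.

  If some neighbourhood \<open>U\<close> of the identity has no element with hyperbolic image, take \<open>V\<close> with
  \<open>V V \<subseteq> U\<close>. Two non-trivial elliptic elements whose product is not hyperbolic fix the same vertex
  (\<open>elliptic_mult_same_factor\<close>), so all of \<open>\<phi>(V)\<close> fixes one vertex \<open>P\<close>. If \<open>\<phi>\<close> is not continuous,
  every neighbourhood of the identity contains elements outside the kernel; applied to
  \<open>V \<inter> x\<^sup>-\<^sup>1 V x\<close> this yields a non-trivial element of \<open>\<phi>(V)\<close> that \<open>\<phi>(x)\<close> conjugates into \<open>\<phi>(V)\<close>,
  whence \<open>\<phi>(x) P = P\<close> for every \<open>x\<close>. This puts the image into a conjugate of a factor.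

  The other case is impossible, by an argument in the spirit of Dudley's theorem on homomorphisms
  into free groups. From a small \<open>g\<close> with hyperbolic image build the self-map
  \<open>W(x) = g (x\<^sup>n g x\<^sup>n g\<^sup>-\<^sup>1)\<^sup>N\<close> of \<open>G\<close>. It is continuous and sends the identity to \<open>g\<close>, and for suitable
  \<open>n\<close> and \<open>N\<close> (depending only on the length of \<open>\<phi>(g)\<close>) the image of \<open>W(x)\<close> is hyperbolic for
  every \<open>x\<close>, with a larger translation length than the image of \<open>x\<close> if that one is hyperbolic
  (\<open>spread_expanding\<close>). Completeness of \<open>G\<close> gives maps \<open>W\<^sub>k\<close> of this kind and points
  with \<open>y\<^sub>k = W\<^sub>k(y\<^sub>k\<^sub>+\<^sub>1)\<close> for all \<open>k\<close> (\<open>infinite_iteration\<close>). Then all \<open>\<phi>(y\<^sub>k)\<close> are hyperbolic and the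
  translation length of \<open>\<phi>(y\<^sub>0)\<close> exceeds every integer.

  Why \<open>W\<close> has these properties: let \<open>x\<close> stand for its own image. If \<open>x\<close> is hyperbolic, its axis
  cannot overlap the translate of that axis by \<open>g\<close>, in opposite directions, for more than about one
  period of \<open>x\<close>, unless \<open>g\<close> inverts \<open>x\<close>, which hyperbolic elements never do. Hence high powers of \<open>x\<close>
  separated by bounded elements cancel only boundedly (\<open>axis_overlap\<close>). If \<open>x\<^sup>n\<close> is elliptic and not
  trivial, then \<open>x\<^sup>n\<close> and \<open>g x\<^sup>n g\<^sup>-\<^sup>1\<close> fix different vertices, so their product is hyperbolic. If
  \<open>x\<^sup>n\<close> is trivial, then \<open>W(x) = g\<close>.
\<close>

section \<open>Groups with an integral Lyndon length function\<close>

text \<open>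
  The value \<open>len x\<close> is to be thought of as the distance by which \<open>x\<close> moves a base point of a tree on
  which the group acts. In a tree \<open>len x + len y - len (inv x \<otimes> y)\<close> is twice the length of
  the common initial segment of the geodesics from the base point \<open>o\<close> to \<open>x o\<close> and to \<open>y o\<close>, and for such
  segments the ultrametric inequality is evident. By the first axiom only the unit fixes \<open>o\<close>. The
  last one says that integral points of the geodesic from \<open>o\<close> to \<open>x o\<close> belong to the orbit of
  \<open>o\<close>.
\<close>

locale lyndon_group = group \<Gamma> for \<Gamma> (structure) +
  fixes len :: "'a \<Rightarrow> int"
  assumes len_eq_0_iff: "x \<in> carrier \<Gamma> \<Longrightarrow> len x = 0 \<longleftrightarrow> x = \<one>"
    and len_inv: "x \<in> carrier \<Gamma> \<Longrightarrow> len (inv x) = len x"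
    and len_ultrametric:
      "\<lbrakk>x \<in> carrier \<Gamma>; y \<in> carrier \<Gamma>; z \<in> carrier \<Gamma>\<rbrakk> \<Longrightarrow>
        min (len x + len y - len (inv x \<otimes> y)) (len y + len z - len (inv y \<otimes> z))
        \<le> len x + len z - len (inv x \<otimes> z)"
    and len_prefix:
      "\<lbrakk>x \<in> carrier \<Gamma>; 0 \<le> k; k \<le> len x\<rbrakk> \<Longrightarrow>
        \<exists>p\<in>carrier \<Gamma>. len p = k \<and> len (inv p \<otimes> x) = len x - k"
begin

subsection \<open>The tree metric\<close>

definition wdist :: "'a \<Rightarrow> 'a \<Rightarrow> int" where
  "wdist x y = len (inv x \<otimes> y)"

lemma len_one [simp]: "len \<one> = 0"
  by (simp add: len_eq_0_iff)

lemma wdist_one [simp]: "x \<in> carrier \<Gamma> \<Longrightarrow> wdist \<one> x = len x"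
  by (simp add: wdist_def)

lemma wdist_self [simp]: "x \<in> carrier \<Gamma> \<Longrightarrow> wdist x x = 0"
  by (simp add: wdist_def)

lemma wdist_commute: "\<lbrakk>x \<in> carrier \<Gamma>; y \<in> carrier \<Gamma>\<rbrakk> \<Longrightarrow> wdist x y = wdist y x"
  using len_inv[of "inv x \<otimes> y"] by (simp add: wdist_def inv_mult_group)

lemma wdist_mult_left:
  assumes "g \<in> carrier \<Gamma>" "x \<in> carrier \<Gamma>" "y \<in> carrier \<Gamma>"
  shows "wdist (g \<otimes> x) (g \<otimes> y) = wdist x y"
proof -
  have "inv g \<otimes> (g \<otimes> y) = y"
    using assms by (simp flip: m_assoc)
  then have "inv (g \<otimes> x) \<otimes> (g \<otimes> y) = inv x \<otimes> y"
    using assms by (simp add: inv_mult_group m_assoc)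
  then show ?thesis using assms by (simp add: wdist_def)
qed

lemma wdist_mult_right: "\<lbrakk>x \<in> carrier \<Gamma>; y \<in> carrier \<Gamma>\<rbrakk> \<Longrightarrow> wdist x (x \<otimes> y) = len y"
  using wdist_mult_left[of x \<one> y] by simp

text \<open>
  Translation by \<open>inv w\<close> moves the ultrametric inequality from the unit to the base point \<open>w\<close>.
\<close>

lemma wdist_ultra:
  assumes "w \<in> carrier \<Gamma>" "x \<in> carrier \<Gamma>" "y \<in> carrier \<Gamma>" "z \<in> carrier \<Gamma>"
  shows "wdist w x + wdist w y - wdist x y \<le> wdist w x + wdist w z - wdist x z \<or>
         wdist w y + wdist w z - wdist y z \<le> wdist w x + wdist w z - wdist x z"
proof -
  have *: "wdist a b = wdist (inv w \<otimes> a) (inv w \<otimes> b)" if "a \<in> carrier \<Gamma>" "b \<in> carrier \<Gamma>" for a b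
    using wdist_mult_left[of "inv w" a b] assms that by simp
  have **: "wdist w a = len (inv w \<otimes> a)" for a by (simp add: wdist_def)
  show ?thesis
    using len_ultrametric[of "inv w \<otimes> x" "inv w \<otimes> y" "inv w \<otimes> z"] assms
    unfolding *[OF assms(2,3)] *[OF assms(3,4)] *[OF assms(2,4)] **
    unfolding wdist_def min_le_iff_disj by simp
qed

lemma four_point:
  assumes "x \<in> carrier \<Gamma>" "y \<in> carrier \<Gamma>" "z \<in> carrier \<Gamma>" "w \<in> carrier \<Gamma>"
  shows "wdist x y + wdist z w \<le> wdist x z + wdist y w \<or> wdist x y + wdist z w \<le> wdist x w + wdist y z"
  using wdist_ultra[of w x z y] assms
  by (simp add: wdist_commute[of w] wdist_commute[of z y]) linarith

lemma wdist_triangle: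
  assumes "x \<in> carrier \<Gamma>" "y \<in> carrier \<Gamma>" "z \<in> carrier \<Gamma>"
  shows "wdist x y \<le> wdist x z + wdist z y"
  using four_point[of x y z z] assms by (simp add: wdist_commute[of z y])

lemma wdist_eq_0_iff: "\<lbrakk>x \<in> carrier \<Gamma>; y \<in> carrier \<Gamma>\<rbrakk> \<Longrightarrow> wdist x y = 0 \<longleftrightarrow> x = y"
  unfolding wdist_def
  by (metis inv_closed inv_equality inv_inv len_eq_0_iff m_closed r_inv)

lemma wdist_nonneg: "\<lbrakk>x \<in> carrier \<Gamma>; y \<in> carrier \<Gamma>\<rbrakk> \<Longrightarrow> 0 \<le> wdist x y"
  using wdist_triangle[of x x y] wdist_commute[of x y] by simp

lemma len_nonneg: "x \<in> carrier \<Gamma> \<Longrightarrow> 0 \<le> len x"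
  using wdist_nonneg[of \<one> x] by simp

lemma len_mult_le: "\<lbrakk>x \<in> carrier \<Gamma>; y \<in> carrier \<Gamma>\<rbrakk> \<Longrightarrow> len (x \<otimes> y) \<le> len x + len y"
  using wdist_triangle[of \<one> "x \<otimes> y" x] wdist_mult_right[of x y] by simp

lemma len_mult_ge:
  assumes "x \<in> carrier \<Gamma>" "y \<in> carrier \<Gamma>"
  shows "len x - len y \<le> len (x \<otimes> y)" "len y - len x \<le> len (x \<otimes> y)"
  using wdist_triangle[of \<one> x "x \<otimes> y"] wdist_triangle[of x "x \<otimes> y" \<one>]
    wdist_mult_right[of x y] assms
    wdist_commute[of x \<one>] wdist_commute[of "x \<otimes> y" x]
  by simp_all

definition between :: "'a \<Rightarrow> 'a \<Rightarrow> 'a \<Rightarrow> bool" where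
  "between x p y \<longleftrightarrow> wdist x p + wdist p y = wdist x y"

lemma between_mult_left:
  "\<lbrakk>g \<in> carrier \<Gamma>; x \<in> carrier \<Gamma>; p \<in> carrier \<Gamma>; y \<in> carrier \<Gamma>\<rbrakk> \<Longrightarrow>
    between (g \<otimes> x) (g \<otimes> p) (g \<otimes> y) \<longleftrightarrow> between x p y"
  by (simp add: between_def wdist_mult_left)

lemma between_commute:
  "\<lbrakk>x \<in> carrier \<Gamma>; p \<in> carrier \<Gamma>; y \<in> carrier \<Gamma>\<rbrakk> \<Longrightarrow> between x p y \<longleftrightarrow> between y p x"
  by (auto simp: between_def wdist_commute)

text \<open>
  Two geodesics from \<open>x\<close> share every point up to half of the quantity on the right-hand side.
\<close>

lemma between_transport:
  assumes "x \<in> carrier \<Gamma>" "p \<in> carrier \<Gamma>" "u \<in> carrier \<Gamma>" "v \<in> carrier \<Gamma>"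
    and "between x p u" "2 * wdist x p \<le> wdist x u + wdist x v - wdist u v"
  shows "between x p v"
  using four_point[of p v x u] wdist_triangle[of x v p] assms
    wdist_commute[of p x] wdist_commute[of v u] wdist_commute[of v x]
  unfolding between_def by linarith

lemma between_unique:
  assumes "x \<in> carrier \<Gamma>" "p \<in> carrier \<Gamma>" "q \<in> carrier \<Gamma>" "u \<in> carrier \<Gamma>"
    and "between x p u" "between x q u" "wdist x p = wdist x q"
  shows "p = q"
proof -
  have "wdist p q \<le> 0"
    using wdist_ultra[of x p u q] assms wdist_commute[of u q]
    unfolding between_def by linarith
  then show ?thesis
    using wdist_nonneg[of p q] wdist_eq_0_iff[of p q] assms by simp
qed

lemma exists_between:
  assumes "x \<in> carrier \<Gamma>" "0 \<le> k" "k \<le> len x"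
  shows "\<exists>p\<in>carrier \<Gamma>. len p = k \<and> between \<one> p x"
  using len_prefix[OF assms] assms(1) unfolding between_def by (auto simp: wdist_def)

subsection \<open>Hyperbolic elements\<close>

definition hyperbolic :: "'a \<Rightarrow> bool" where
  "hyperbolic z \<longleftrightarrow> len z < len (z \<otimes> z)"

text \<open>
  For a hyperbolic element this is the translation length along its axis: squaring doubles the
  part of the path that runs along the axis and keeps the way from the base point to the axis and
  back. For elliptic elements it is not positive.
\<close>

definition trans_len :: "'a \<Rightarrow> int" where
  "trans_len z = len (z \<otimes> z) - len z"

lemma hyperbolic_iff: "hyperbolic z \<longleftrightarrow> 0 < trans_len z"
  by (auto simp: hyperbolic_def trans_len_def)

lemma trans_len_le: "z \<in> carrier \<Gamma> \<Longrightarrow> trans_len z \<le> len z"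
  using len_mult_le[of z z] by (simp add: trans_len_def)

text \<open>
  The statement covers two consecutive powers because the length of the next one is found from the
  four points \<open>\<one>\<close>, \<open>z\<close>, \<open>z\<^sup>2\<close> and \<open>z\<^sup>n\<^sup>+\<^sup>1\<close>.
\<close>

lemma len_pow_aux:
  assumes z: "z \<in> carrier \<Gamma>" and h: "hyperbolic z"
  shows "len (z [^] Suc n) = len z + int n * trans_len z \<and>
    len (z [^] Suc (Suc n)) = len z + int (Suc n) * trans_len z"
proof (induction n)
  case 0
  show ?case using z by (simp add: trans_len_def)
next
  case (Suc n)
  let ?x = "z [^] Suc n"
  have c: "?x \<in> carrier \<Gamma>" "z \<otimes> ?x \<in> carrier \<Gamma>" using z by auto
  have s1: "z [^] Suc (Suc n) = z \<otimes> ?x" "z [^] Suc (Suc (Suc n)) = z \<otimes> (z \<otimes> ?x)"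
    using z by (metis nat_pow_Suc2)+
  have d: "wdist (z \<otimes> z) (z \<otimes> (z \<otimes> ?x)) = wdist z (z \<otimes> ?x)"
    "wdist z (z \<otimes> ?x) = len ?x" "wdist z (z \<otimes> (z \<otimes> ?x)) = len (z \<otimes> ?x)" "wdist z (z \<otimes> z) = len z"
    using z c wdist_mult_left[of z z "z \<otimes> ?x"] by (simp_all add: wdist_mult_right)
  have ih: "len ?x = len z + int n * trans_len z" "len (z \<otimes> ?x) = len ?x + trans_len z"
    using Suc.IH unfolding s1 by (auto simp: algebra_simps)
  have p: "0 < trans_len z" using h by (simp add: hyperbolic_iff)
  have zz: "len (z \<otimes> z) = len z + trans_len z" by (simp add: trans_len_def)
  have c1: "wdist \<one> z = len z" "wdist \<one> (z \<otimes> z) = len (z \<otimes> z)"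
    "wdist \<one> (z \<otimes> (z \<otimes> ?x)) = len (z \<otimes> (z \<otimes> ?x))"
    "wdist (z \<otimes> z) \<one> = len (z \<otimes> z)" "wdist z \<one> = len z"
    using z c by (simp_all add: wdist_commute[of _ \<one>])
  have "len (z \<otimes> (z \<otimes> ?x)) = len (z \<otimes> ?x) + trans_len z"
    using four_point[of \<one> "z \<otimes> (z \<otimes> ?x)" z "z \<otimes> z"] four_point[of \<one> "z \<otimes> z" z "z \<otimes> (z \<otimes> ?x)"]
      z c d ih p zz c1 wdist_commute[of "z \<otimes> z" "z \<otimes> (z \<otimes> ?x)"]
      wdist_commute[of z "z \<otimes> (z \<otimes> ?x)"] wdist_commute[of z "z \<otimes> z"]
    by simp
  then show ?case using ih Suc.IH unfolding s1(2) by (simp add: algebra_simps s1(1))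
qed

subsection \<open>Powers and conjugates\<close>

lemma conj_inv_conj:
  assumes "q \<in> carrier \<Gamma>" "b \<in> carrier \<Gamma>"
  shows "q \<otimes> (inv q \<otimes> b \<otimes> q) \<otimes> inv q = b"
proof -
  have "q \<otimes> (inv q \<otimes> (b \<otimes> (q \<otimes> inv q))) = b"
    using assms by (simp flip: m_assoc)
  then show ?thesis using assms by (simp add: m_assoc)
qed

lemma conj_eq_one:
  assumes "q \<in> carrier \<Gamma>" "b \<in> carrier \<Gamma>" "inv q \<otimes> b \<otimes> q = \<one>"
  shows "b = \<one>"
  using conj_inv_conj[OF assms(1,2)] assms by simp

lemma group_hom_conj:
  assumes p: "p \<in> carrier \<Gamma>"
  shows "group_hom \<Gamma> \<Gamma> (\<lambda>x. inv p \<otimes> x \<otimes> p)"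
proof -
  have "p \<otimes> (inv p \<otimes> (y \<otimes> p)) = y \<otimes> p" if "y \<in> carrier \<Gamma>" for y
    using p that by (simp flip: m_assoc)
  then have "(\<lambda>x. inv p \<otimes> x \<otimes> p) \<in> hom \<Gamma> \<Gamma>"
    using p by (intro homI) (simp_all add: m_assoc)
  then show ?thesis using is_group by (simp add: group_hom_def group_hom_axioms_def)
qed

lemma len_pow:
  assumes "z \<in> carrier \<Gamma>" "hyperbolic z" "n > 0"
  shows "len (z [^] n) = len z + (int n - 1) * trans_len z"
  using len_pow_aux[OF assms(1,2), of "n - 1"] assms(3) by (simp add: of_nat_diff)

text \<open>
  The orbit of the base point under an elliptic element stays on a sphere around a fixed point. So
  unbounded powers characterise hyperbolic elements, which makes the notion conjugation
  invariant.
\<close>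

lemma len_pow_not_hyperbolic:
  assumes z: "z \<in> carrier \<Gamma>" and h: "\<not> hyperbolic z"
  shows "len (z [^] n) \<le> len z \<and> len (z [^] Suc n) \<le> len z"
proof (induction n)
  case 0
  show ?case using z len_nonneg by simp
next
  case (Suc n)
  let ?x = "z [^] n"
  have c: "?x \<in> carrier \<Gamma>" using z by auto
  have s: "z [^] Suc n = z \<otimes> ?x" "z [^] Suc (Suc n) = z \<otimes> (z \<otimes> ?x)"
    using z by (metis nat_pow_Suc2 nat_pow_closed)+
  have d: "wdist (z \<otimes> z) (z \<otimes> (z \<otimes> ?x)) = wdist z (z \<otimes> ?x)"
    "wdist z (z \<otimes> ?x) = len ?x" "wdist z (z \<otimes> (z \<otimes> ?x)) = len (z \<otimes> ?x)" "wdist z (z \<otimes> z) = len z"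
    using z c wdist_mult_left[of z z "z \<otimes> ?x"] by (simp_all add: wdist_mult_right)
  have "len (z \<otimes> z) \<le> len z" using h by (simp add: hyperbolic_def)
  then have "len (z \<otimes> (z \<otimes> ?x)) \<le> len z"
    using four_point[of \<one> "z \<otimes> (z \<otimes> ?x)" z "z \<otimes> z"] z c d Suc.IH s
      wdist_commute[of "z \<otimes> z" "z \<otimes> (z \<otimes> ?x)"] wdist_commute[of "z \<otimes> (z \<otimes> ?x)" z]
    by (simp add: wdist_commute[of _ \<one>]) linarith
  then show ?case using Suc.IH unfolding s(2) by simp
qed

lemma conj_pow:
  assumes "p \<in> carrier \<Gamma>" "z \<in> carrier \<Gamma>"
  shows "(p \<otimes> z \<otimes> inv p) [^] (n::nat) = p \<otimes> z [^] n \<otimes> inv p"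
proof (induction n)
  case (Suc n)
  have "inv p \<otimes> (p \<otimes> (z \<otimes> inv p)) = z \<otimes> inv p"
    using assms by (simp flip: m_assoc)
  then show ?case using assms Suc by (simp add: m_assoc)
qed (use assms in simp)

lemma hyperbolic_if_len_pow_unbounded:
  assumes "z \<in> carrier \<Gamma>" "\<And>b. \<exists>n. b < len (z [^] (n::nat))"
  shows "hyperbolic z"
  using len_pow_not_hyperbolic[OF assms(1)] assms(2) by (meson not_le)

lemma len_pow_unbounded:
  assumes "z \<in> carrier \<Gamma>" "hyperbolic z"
  shows "\<exists>n>0. b < len (z [^] (n::nat))"
proof -
  let ?n = "Suc (nat \<bar>b\<bar> + 1)"
  have t: "1 \<le> trans_len z" using assms(2) by (simp add: hyperbolic_iff)
  then have "int ?n - 1 \<le> (int ?n - 1) * trans_len z"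
    using mult_left_mono[of 1 "trans_len z" "int ?n - 1"] by simp
  moreover have "b < int ?n - 1" by simp
  ultimately have "b < len (z [^] ?n)"
    using len_pow[OF assms, of ?n] len_nonneg[OF assms(1)] by simp
  then show ?thesis by blast
qed

lemma hyperbolic_pow_imp:
  assumes z: "z \<in> carrier \<Gamma>" and h: "hyperbolic (z [^] (n::nat))"
  shows "hyperbolic z"
proof (rule hyperbolic_if_len_pow_unbounded[OF z])
  fix b
  obtain m where "b < len ((z [^] n) [^] (m::nat))"
    using len_pow_unbounded[OF _ h] z by auto
  then show "\<exists>n. b < len (z [^] (n::nat))"
    using z by (auto simp: nat_pow_pow)
qed

lemma len_conj_bounds:
  assumes "p \<in> carrier \<Gamma>" "z \<in> carrier \<Gamma>"
  shows "len z - 2 * len p \<le> len (p \<otimes> z \<otimes> inv p)" "len (p \<otimes> z \<otimes> inv p) \<le> len z + 2 * len p"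
  using len_mult_ge[of p z] len_mult_ge[of "p \<otimes> z" "inv p"] len_mult_le[of p z]
    len_mult_le[of "p \<otimes> z" "inv p"] len_inv[of p] assms by auto

lemma hyperbolic_conj_imp:
  assumes "p \<in> carrier \<Gamma>" "z \<in> carrier \<Gamma>" "hyperbolic z"
  shows "hyperbolic (p \<otimes> z \<otimes> inv p)"
proof (rule hyperbolic_if_len_pow_unbounded)
  fix b
  obtain n where "b + 2 * len p < len (z [^] (n::nat))"
    using len_pow_unbounded assms by blast
  then have "b < len ((p \<otimes> z \<otimes> inv p) [^] n)"
    using len_conj_bounds[of p "z [^] n"] assms by (simp add: conj_pow)
  then show "\<exists>n. b < len ((p \<otimes> z \<otimes> inv p) [^] (n::nat))" by blast
qed (use assms in simp)

lemma hyperbolic_conj: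
  assumes "p \<in> carrier \<Gamma>" "z \<in> carrier \<Gamma>"
  shows "hyperbolic (p \<otimes> z \<otimes> inv p) \<longleftrightarrow> hyperbolic z"
proof -
  have "inv p \<otimes> (p \<otimes> z \<otimes> inv p) \<otimes> inv (inv p) = z"
    using assms by (simp add: m_assoc inv_solve_left')
  then show ?thesis
    using hyperbolic_conj_imp[of p z] hyperbolic_conj_imp[of "inv p" "p \<otimes> z \<otimes> inv p"] assms
    by (metis inv_closed m_closed)
qed

lemma hyperbolic_inv:
  assumes "z \<in> carrier \<Gamma>" shows "hyperbolic (inv z) \<longleftrightarrow> hyperbolic z"
    "trans_len (inv z) = trans_len z"
  using len_inv[of z] len_inv[of "z \<otimes> z"] assms
  by (simp_all add: hyperbolic_def trans_len_def inv_mult_group)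

text \<open>
  If \<open>g\<close> inverts \<open>x\<close>, then \<open>(g x\<^sup>n)\<^sup>2 = g\<^sup>2\<close> for all \<open>n\<close>. For large \<open>n\<close> the element \<open>g x\<^sup>n\<close> is longer than
  its square, hence not hyperbolic, while \<open>g\<^sup>2\<close> is hyperbolic.
\<close>

lemma hyperbolic_not_inverting:
  assumes g: "g \<in> carrier \<Gamma>" "hyperbolic g" and x: "x \<in> carrier \<Gamma>" "hyperbolic x"
  shows "g \<otimes> x \<otimes> inv g \<noteq> inv x"
proof
  assume eq: "g \<otimes> x \<otimes> inv g = inv x"
  have sq: "(g \<otimes> x [^] (n::nat)) \<otimes> (g \<otimes> x [^] n) = g \<otimes> g" for n
  proof -
    have "g \<otimes> x [^] n \<otimes> inv g = inv (x [^] n)"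
      using conj_pow[OF g(1) x(1), of n] eq x(1) by (simp add: nat_pow_inv)
    then have "x [^] n \<otimes> (g \<otimes> x [^] n \<otimes> inv g) = \<one>" using x by simp
    then have "x [^] n \<otimes> g \<otimes> x [^] n = g"
      using g x by (metis inv_closed inv_equality inv_inv m_assoc m_closed nat_pow_closed)
    then show ?thesis using g x by (simp add: m_assoc)
  qed
  obtain n where n: "len g + len (g \<otimes> g) < len (x [^] (n::nat))"
    using len_pow_unbounded[OF x] by blast
  let ?z = "g \<otimes> x [^] n"
  have z: "?z \<in> carrier \<Gamma>" using g x by simp
  have "\<not> hyperbolic ?z"
    using n len_mult_ge(2)[of g "x [^] n"] g x by (simp add: hyperbolic_def sq)
  then have "\<not> hyperbolic (?z [^] (2::nat))" using hyperbolic_pow_imp z by blast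
  moreover have "?z [^] (2::nat) = g [^] (2::nat)" using sq[of n] z g by (simp add: numeral_2_eq_2)
  moreover have "hyperbolic (g [^] (2::nat))"
  proof (rule hyperbolic_if_len_pow_unbounded)
    fix b
    obtain m where "b + len g < len (g [^] (m::nat))" "m > 0" using len_pow_unbounded[OF g] by blast
    moreover have "len (g [^] m) \<le> len ((g [^] (2::nat)) [^] m)"
      using \<open>m > 0\<close> g by (simp add: nat_pow_pow len_pow hyperbolic_iff mult_right_mono)
    ultimately have "b < len ((g [^] (2::nat)) [^] m)" using len_nonneg[OF g(1)] by linarith
    then show "\<exists>n. b < len ((g [^] (2::nat)) [^] (n::nat))" by blast
  qed (use g in simp)
  ultimately show False by simp
qed

subsection \<open>Overlaps of axes\<close>

text \<open>
  The difference \<open>len x - trans_len x\<close> is twice the distance from the base point to the axis of \<open>x\<close>.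
  The bounds \<open>lo\<close> and \<open>hi\<close> keep both \<open>p\<close> and its image in the part of the geodesic that lies on
  the axis, where \<open>x\<close> acts as translation.
\<close>

lemma pow_shift:
  assumes x: "x \<in> carrier \<Gamma>" "hyperbolic x" and p: "p \<in> carrier \<Gamma>" and n: "n > 0"
    and b: "between \<one> p (x [^] (n::nat))"
    and lo: "len x - trans_len x \<le> 2 * len p"
    and hi: "2 * len p + 2 * trans_len x \<le> 2 * int n * trans_len x + (len x - trans_len x)"
  shows "between \<one> (x \<otimes> p) (x [^] n)" "len (x \<otimes> p) = len p + trans_len x"
proof -
  let ?T = "trans_len x" and ?E = "len x - trans_len x"
  have T: "0 < ?T" using x by (simp add: hyperbolic_iff)
  have ln: "len (x [^] n) = int n * ?T + ?E" using len_pow[OF x n] by (simp add: algebra_simps)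
  have ln': "len (x [^] Suc n) = int n * ?T + ?T + ?E"
    using len_pow[OF x, of "Suc n"] by (simp add: algebra_simps)
  have s: "x [^] Suc n = x \<otimes> x [^] n" using x by (metis nat_pow_Suc2)
  have cl: "x [^] n \<in> carrier \<Gamma>" "x [^] Suc n \<in> carrier \<Gamma>" "x \<otimes> p \<in> carrier \<Gamma>" using x p by auto
  have dp: "wdist p (x [^] n) = int n * ?T + ?E - len p"
    using b cl p ln by (simp add: between_def)
  have dxp: "wdist (x \<otimes> p) (x [^] Suc n) = int n * ?T + ?E - len p"
    using dp wdist_mult_left[of x p "x [^] n"] x p unfolding s by simp
  have dx: "wdist x (x \<otimes> p) = len p" "wdist x (x [^] Suc n) = len (x [^] n)"
    using x p cl unfolding s by (simp_all add: wdist_mult_right)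
  have "len (x \<otimes> p) \<le> len p + ?T"
    using four_point[of \<one> "x \<otimes> p" x "x [^] Suc n"] x p cl dxp dx ln ln' lo
    by (simp add: wdist_commute[of _ \<one>] wdist_commute[of "x [^] Suc n"]
        wdist_commute[of "x \<otimes> p" x] del: nat_pow_Suc) linarith
  moreover have "len p + ?T \<le> len (x \<otimes> p)"
    using wdist_triangle[of \<one> "x [^] Suc n" "x \<otimes> p"] x p cl dxp ln'
    by (simp del: nat_pow_Suc)
  ultimately show l: "len (x \<otimes> p) = len p + ?T" by simp
  have "between \<one> (x \<otimes> p) (x [^] Suc n)"
    using l dxp ln' cl by (simp add: between_def del: nat_pow_Suc)
  moreover have "wdist (x [^] Suc n) (x [^] n) = len x"
    using x cl wdist_mult_right[of "x [^] n" x] by (simp add: wdist_commute[of "x [^] n \<otimes> x"])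
  ultimately show "between \<one> (x \<otimes> p) (x [^] n)"
    using between_transport[of \<one> "x \<otimes> p" "x [^] Suc n" "x [^] n"] cl l ln ln' hi
    by (simp del: nat_pow_Suc)
qed

text \<open>
  Suppose that much cancels in \<open>x\<^sup>n g x\<^sup>n\<close>. Then the geodesics from the base point to \<open>x\<^sup>-\<^sup>n\<close> and to
  \<open>g x\<^sup>n\<close> agree so long that for at least one period of \<open>x\<close> their common part runs along the axis
  of \<open>x\<^sup>-\<^sup>1\<close> and along the axis of \<open>g x g\<^sup>-\<^sup>1\<close>. Both elements then move a point \<open>p\<close> at the start of that
  stretch forward by the translation length of \<open>x\<close>, so they agree at \<open>p\<close>. Since the group acts freely
  on itself, they are equal.
\<close>

lemma axis_overlap:
  assumes x: "x \<in> carrier \<Gamma>" "hyperbolic x" and g: "g \<in> carrier \<Gamma>"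
    and ni: "g \<otimes> x \<otimes> inv g \<noteq> inv x"
    and n: "2 * len g + trans_len x + 1 \<le> int n * trans_len x"
  shows "len (x [^] n) + len (g \<otimes> x [^] n)
      - (len x - trans_len x) - 2 * len g - 2 * trans_len x \<le> len (x [^] n \<otimes> g \<otimes> x [^] n)"
proof (rule ccontr)
  let ?T = "trans_len x" and ?E = "len x - trans_len x" and ?y = "inv x"
  assume "\<not> ?thesis"
  then have short: "len (x [^] n \<otimes> g \<otimes> x [^] n)
      < len (x [^] n) + len (g \<otimes> x [^] n) - ?E - 2 * len g - 2 * ?T" by simp
  have T: "0 < ?T" using x by (simp add: hyperbolic_iff)
  have E: "0 \<le> ?E" using trans_len_le x by simp
  have n0: "n > 0" using n T len_nonneg[OF g] by (cases n) auto
  have y: "?y \<in> carrier \<Gamma>" "hyperbolic ?y" "trans_len ?y = ?T" "len ?y = len x"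
    using x hyperbolic_inv len_inv by auto
  let ?u = "?y [^] n" and ?v = "g \<otimes> x [^] n" and ?w = "x [^] n"
  have u: "?u = inv ?w" using x by (simp add: nat_pow_inv)
  have cl: "?u \<in> carrier \<Gamma>" "?v \<in> carrier \<Gamma>" "?w \<in> carrier \<Gamma>" using x g by auto
  have lw: "len ?w = int n * ?T + ?E" using len_pow[OF x n0] by (simp add: algebra_simps)
  have lu: "len ?u = len ?w" using cl len_inv by (simp add: u)
  have uv: "wdist ?u ?v < len ?w + len ?v - ?E - 2 * len g - 2 * ?T"
    using short cl x g unfolding u by (simp add: wdist_def m_assoc)
  \<comment> \<open>\<open>?E\<close> is twice the distance to the axis; from \<open>r\<close> on, both geodesics have reached their axes\<close>
  define r where "r = len g + (?E + 1) div 2"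
  have r: "?E + 2 * len g \<le> 2 * r" "2 * r \<le> ?E + 2 * len g + 1"
  proof -
    have "e \<le> 2 * ((e + 1) div 2)" "2 * ((e + 1) div 2) \<le> e + 1" for e :: int by presburger+
    from this[of ?E] show "?E + 2 * len g \<le> 2 * r" "2 * r \<le> ?E + 2 * len g + 1"
      unfolding r_def by auto
  qed
  have L: "0 \<le> len g" using g len_nonneg by simp
  have "0 \<le> r" "r \<le> len ?u" using r L E lu lw n T by linarith+
  then obtain p where p: "p \<in> carrier \<Gamma>" "len p = r" "between \<one> p ?u"
    using exists_between cl by blast
  have v: "len ?w - len g \<le> len ?v" "len ?v \<le> len ?w + len g"
    using len_mult_ge[of g ?w] len_mult_le[of g ?w] cl g by auto
  \<comment> \<open>the inverse of \<open>x\<close> translates \<open>p\<close> along the geodesic to \<open>?u\<close>\<close>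
  have bu: "between \<one> (?y \<otimes> p) ?u" "len (?y \<otimes> p) = r + ?T"
    using pow_shift[OF y(1,2) p(1) n0 p(3)] r n y(3,4) p(2) L by auto
  \<comment> \<open>\<open>p\<close> also lies on the geodesic from \<open>g\<close> to \<open>?v\<close>, the translate by \<open>g\<close> of the one to \<open>?w\<close>; there
    the conjugate of \<open>x\<close> by \<open>g\<close> acts as translation\<close>
  have bv: "between \<one> p ?v"
    using between_transport[OF _ p(1) cl(1,2) p(3)] p cl uv lu r T by simp
  have vs: "wdist ?v \<one> = len ?v" "wdist ?v g = len ?w" "wdist \<one> g = len g" "wdist g \<one> = len g"
    using cl g by (simp_all add: wdist_commute[of _ \<one>] wdist_commute[of ?v g] wdist_mult_right)
  have pv: "wdist ?v p = len ?v - r" using bv p cl by (simp add: between_def wdist_commute[of ?v])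
  have bv': "between ?v p g"
    using between_transport[of ?v p \<one> g] bv p cl g vs pv r E v between_commute[of \<one> p ?v] by simp
  define q where "q = inv g \<otimes> p"
  have q: "q \<in> carrier \<Gamma>" "g \<otimes> q = p" using p g by (simp_all add: q_def flip: m_assoc)
  have bq: "between \<one> q ?w"
    using bv' between_mult_left[of g ?w q \<one>] q g cl between_commute[of ?w q \<one>] by simp
  have wq: "wdist ?w q = len ?v - r" using pv wdist_mult_left[of g ?w q] q g cl by simp
  have lq: "len q = len ?w - len ?v + r"
    using bq wq q cl by (simp add: between_def wdist_commute[of ?w])
  have bxq: "between \<one> (x \<otimes> q) ?w" "len (x \<otimes> q) = len q + ?T"
    using pow_shift[OF x q(1) n0 bq] lq r n v L by auto
  let ?s = "g \<otimes> (x \<otimes> q)"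
  have s: "?s \<in> carrier \<Gamma>" using g x q by simp
  have vsd: "wdist ?v ?s = len ?v - r - ?T"
    using wdist_mult_left[of g ?w "x \<otimes> q"] bxq q x g cl lq
    by (simp add: between_def wdist_commute[of ?w])
  have "between ?v ?s g"
    using bxq between_mult_left[of g ?w "x \<otimes> q" \<one>] q x g cl between_commute[of ?w "x \<otimes> q" \<one>]
    by simp
  then have bs: "between ?v ?s \<one>"
    using between_transport[of ?v ?s g \<one>] s cl g vs vsd r E T v by simp
  then have ls: "len ?s = r + ?T"
    using vsd vs s cl by (simp add: between_def wdist_commute[of ?s])
  have "between \<one> ?s ?u"
    using between_transport[of \<one> ?s ?v ?u] bs between_commute[of ?v ?s \<one>] s cl ls uv lu r
      wdist_commute[of ?u ?v] by simp
  then have "?y \<otimes> p = ?s"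
    using between_unique[of \<one> "?y \<otimes> p" ?s ?u] bu ls s cl x p by simp
  also have "\<dots> = g \<otimes> x \<otimes> inv g \<otimes> p"
    using g x p by (simp add: q_def m_assoc)
  finally show False using ni x g p by simp
qed

lemma len_pow_mult_pow:
  assumes x: "x \<in> carrier \<Gamma>" "hyperbolic x" and g: "g \<in> carrier \<Gamma>"
    and ni: "g \<otimes> x \<otimes> inv g \<noteq> inv x"
    and n: "2 * len g + trans_len x + 1 \<le> int n * trans_len x"
  shows "2 * len (x [^] n) - (len x - trans_len x) - 3 * len g - 2 * trans_len x
    \<le> len (x [^] n \<otimes> g \<otimes> x [^] n)"
  using axis_overlap[OF assms] len_mult_ge(2)[of g "x [^] n"] x g by simp

text \<open>
  The error terms involve only \<open>len g\<close> and the translation length of \<open>x\<close>, not the distance from the base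
  point to the axis of \<open>x\<close>: that distance occurs in the length of \<open>g x\<^sup>n\<close> and of its square, and it
  cancels.
\<close>

lemma trans_len_mult_pow:
  assumes x: "x \<in> carrier \<Gamma>" "hyperbolic x" and g: "g \<in> carrier \<Gamma>"
    and ni: "g \<otimes> x \<otimes> inv g \<noteq> inv x"
    and n: "2 * len g + trans_len x + 1 \<le> int n * trans_len x"
  shows "int n * trans_len x - 2 * trans_len x - 5 * len g \<le> trans_len (g \<otimes> x [^] n)"
proof -
  have "n > 0" using n x(2) len_nonneg[OF g] by (cases n) (auto simp: hyperbolic_iff)
  then have l: "len (x [^] n) = int n * trans_len x + (len x - trans_len x)"
    using len_pow[OF x] by (simp add: algebra_simps)
  have "len (x [^] n \<otimes> g \<otimes> x [^] n) - len g \<le> len (g \<otimes> (x [^] n \<otimes> g \<otimes> x [^] n))"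
    using len_mult_ge(2)[of g "x [^] n \<otimes> g \<otimes> x [^] n"] x g by simp
  moreover have "len (g \<otimes> x [^] n) \<le> len g + len (x [^] n)"
    using len_mult_le x g by simp
  ultimately show ?thesis
    using len_pow_mult_pow[OF assms] l x g by (simp add: trans_len_def m_assoc)
qed

text \<open>
  The path through \<open>p\<close>, \<open>q\<close>, \<open>r\<close> and \<open>w\<close> folds back on itself at \<open>q\<close> and at \<open>r\<close>. If the two folds
  together are shorter than the middle edge, they do not meet and the losses add up.
\<close>

lemma wdist_junction:
  assumes c: "p \<in> carrier \<Gamma>" "q \<in> carrier \<Gamma>" "r \<in> carrier \<Gamma>" "w \<in> carrier \<Gamma>"
    and "(wdist p q + wdist q r - wdist p r) + (wdist q r + wdist r w - wdist q w) < 2 * wdist q r"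
  shows "wdist p w = wdist p r + wdist q w - wdist q r"
  using four_point[of p w q r] four_point[of p r q w] assms
    wdist_commute[of r q] wdist_commute[of w q] wdist_commute[of w r] wdist_commute[of q p] by linarith

text \<open>
  In the cyclic word \<open>s t s t\<close> every junction loses a length of at most \<open>k\<close>, and both factors are
  longer than that, so the cancellations do not reach each other.
\<close>

lemma trans_len_mult:
  assumes s: "s \<in> carrier \<Gamma>" and t: "t \<in> carrier \<Gamma>"
    and D: "D \<le> len s" "D \<le> len t"
    and c: "len s + len t - len (s \<otimes> t) \<le> k" "len s + len t - len (t \<otimes> s) \<le> k"
    and k: "k < D"
  shows "2 * (D - k) \<le> trans_len (s \<otimes> t)"
proof -
  let ?p = "s \<otimes> t" let ?q = "?p \<otimes> s" let ?r = "?p \<otimes> ?p"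
  have r: "?r = ?q \<otimes> t" using s t by (simp add: m_assoc)
  have cl: "?p \<in> carrier \<Gamma>" "?q \<in> carrier \<Gamma>" "?r \<in> carrier \<Gamma>" using s t by auto
  have d: "wdist s ?p = len t" "wdist ?p ?q = len s" "wdist ?q ?r = len t" "wdist ?p ?r = len ?p"
    using s t cl wdist_mult_right[of s t] wdist_mult_right[of ?p s] wdist_mult_right[of ?q t]
      wdist_mult_right[of ?p ?p] unfolding r by simp_all
  have d': "wdist s ?q = len (t \<otimes> s)"
    using s t wdist_mult_right[of s "t \<otimes> s"] by (simp add: m_assoc)
  have q: "len ?q = len ?p + len (t \<otimes> s) - len t"
    using wdist_junction[of \<one> s ?p ?q] s t cl d d' c k D by simp
  have "len ?r = len ?q + len ?p - len s"
    using wdist_junction[of \<one> ?p ?q ?r] s t cl d q c k D by simp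
  then show ?thesis using q c D by (simp add: trans_len_def)
qed

text \<open>
  The word is the product of \<open>x\<^sup>n g\<close> and \<open>x\<^sup>n g\<^sup>-\<^sup>1\<close>, and neither \<open>g\<close> nor its inverse inverts \<open>x\<close>.
  The exponent has to be independent of \<open>x\<close>; as each further factor \<open>x\<close> contributes at least the
  translation length of \<open>x\<close>, which is at least one, a multiple of \<open>len g\<close> is enough.
\<close>

lemma trans_len_pow_mult_conj:
  assumes x: "x \<in> carrier \<Gamma>" "hyperbolic x" and g: "g \<in> carrier \<Gamma>" "hyperbolic g"
    and n: "n = nat (7 * len g + 3)"
  shows "trans_len x \<le> trans_len (x [^] n \<otimes> g \<otimes> x [^] n \<otimes> inv g)"
proof -
  let ?T = "trans_len x" and ?L = "len g" and ?w = "x [^] n"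
  have T: "1 \<le> ?T" using x by (simp add: hyperbolic_iff)
  have L: "0 \<le> ?L" using g len_nonneg by simp
  have nn: "int n = 7 * ?L + 3" using n L by simp
  have LT: "?L \<le> ?L * ?T" using mult_left_mono[OF T L] by simp
  have nT: "int n * ?T = 7 * (?L * ?T) + 3 * ?T" by (simp add: nn algebra_simps)
  have n': "2 * ?L + ?T + 1 \<le> int n * ?T" using nT LT T L by linarith
  have i: "inv g \<in> carrier \<Gamma>" "hyperbolic (inv g)" "len (inv g) = ?L"
    using g hyperbolic_inv len_inv by auto
  have w: "?w \<in> carrier \<Gamma>" using x by simp
  have "n > 0" using nn L by linarith
  then have lw: "len ?w = int n * ?T + (len x - ?T)"
    using len_pow[OF x] by (simp add: algebra_simps)
  have 1: "2 * len ?w - (len x - ?T) - 3 * ?L - 2 * ?T \<le> len (?w \<otimes> g \<otimes> ?w)"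
    using len_pow_mult_pow[OF x g(1) hyperbolic_not_inverting[OF g x] n'] .
  have 2: "2 * len ?w - (len x - ?T) - 3 * ?L - 2 * ?T \<le> len (?w \<otimes> inv g \<otimes> ?w)"
    using len_pow_mult_pow[OF x i(1) hyperbolic_not_inverting[OF i(1,2) x]] n' i by simp
  let ?s = "?w \<otimes> g" and ?t = "?w \<otimes> inv g"
  have st: "?s \<in> carrier \<Gamma>" "?t \<in> carrier \<Gamma>" using w g i by auto
  have ls: "len ?w - ?L \<le> len ?s" "len ?s \<le> len ?w + ?L" "len ?w - ?L \<le> len ?t" "len ?t \<le> len ?w + ?L"
    using len_mult_ge(1)[OF w g(1)] len_mult_ge(1)[OF w i(1)] len_mult_le[OF w g(1)]
      len_mult_le[OF w i(1)] i(3) by auto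
  have "?s \<otimes> ?t = (?w \<otimes> g \<otimes> ?w) \<otimes> inv g" "?t \<otimes> ?s = (?w \<otimes> inv g \<otimes> ?w) \<otimes> g"
    using w g by (simp_all add: m_assoc)
  then have lst: "len (?w \<otimes> g \<otimes> ?w) - ?L \<le> len (?s \<otimes> ?t)" "len (?w \<otimes> inv g \<otimes> ?w) - ?L \<le> len (?t \<otimes> ?s)"
    using len_mult_ge(1)[of "?w \<otimes> g \<otimes> ?w" "inv g"] len_mult_ge(1)[of "?w \<otimes> inv g \<otimes> ?w" g] w g i(3)
    by auto
  let ?k = "len x - ?T + 6 * ?L + 2 * ?T" and ?D = "len ?w - ?L"
  have "2 * (?D - ?k) \<le> trans_len (?s \<otimes> ?t)"
  proof (rule trans_len_mult[OF st])
    show "len ?s + len ?t - len (?s \<otimes> ?t) \<le> ?k" "len ?s + len ?t - len (?t \<otimes> ?s) \<le> ?k"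
      using ls lst 1 2 by linarith+
    show "?k < ?D" using lw nT LT T L by linarith
  qed (use ls in auto)
  moreover have "?D - ?k = 7 * (?L * ?T) - 7 * ?L + ?T" using lw nT by simp
  then have "?T \<le> ?D - ?k" using LT by simp
  then have "?T \<le> 2 * (?D - ?k)" using T by simp
  ultimately show ?thesis using w g by (simp add: m_assoc)
qed

subsection \<open>Elliptic elements\<close>

text \<open>
  The fixed point of an elliptic element \<open>b\<close> is the midpoint of the geodesic from the base point
  \<open>o\<close> to \<open>b o\<close>. As \<open>b\<close> fixes no orbit point, the midpoint lies half a unit beyond
  the last orbit point \<open>p\<close> of the first half, and \<open>b\<close> moves \<open>p\<close> by just one unit.
\<close>

lemma not_hyperbolic_conj_letter:
  assumes b: "b \<in> carrier \<Gamma>" "b \<noteq> \<one>" "\<not> hyperbolic b"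
  shows "\<exists>p\<in>carrier \<Gamma>. len (inv p \<otimes> b \<otimes> p) = 1"
proof -
  define k where "k = len b div 2"
  have k: "0 \<le> k" "2 * k \<le> len b" "len b \<le> 2 * k + 1" "k \<le> len b"
    using len_nonneg[OF b(1)] unfolding k_def by auto
  obtain p where p: "p \<in> carrier \<Gamma>" "len p = k" "between \<one> p b"
    using exists_between[OF b(1)] k by blast
  have bb: "len (b \<otimes> b) \<le> len b" using b by (simp add: hyperbolic_def)
  have "between \<one> p (inv b)"
    using between_transport[of \<one> p b "inv b"] p b bb k len_inv[of b] len_inv[of "b \<otimes> b"]
      wdist_commute[of b "inv b"]
    by (simp add: wdist_def)
  then have "len (b \<otimes> p) = len b - k"
    using b p len_inv[of b] wdist_mult_left[of b p "inv b"]
    by (simp add: between_def wdist_commute[of _ \<one>])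
  moreover have "wdist (b \<otimes> p) b = k"
    using b p wdist_mult_right[of b p] by (simp add: wdist_commute[of "b \<otimes> p"])
  ultimately have "wdist p (b \<otimes> p) \<le> 1"
    using wdist_ultra[of \<one> p b "b \<otimes> p"] p b k wdist_commute[of b "b \<otimes> p"]
    by (auto simp: between_def)
  moreover have "wdist p (b \<otimes> p) \<noteq> 0"
    using p b by (simp add: wdist_eq_0_iff)
  moreover have "wdist p (b \<otimes> p) = len (inv p \<otimes> b \<otimes> p)"
    using p b by (simp add: wdist_def m_assoc)
  ultimately have "len (inv p \<otimes> b \<otimes> p) = 1"
    using wdist_nonneg[of p "b \<otimes> p"] p b by simp
  then show ?thesis using p by blast
qed

text \<open>
  The length hypotheses say that the geodesics towards \<open>a\<close> and towards \<open>inv a\<close> both leave the base point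
  in another direction than the one towards \<open>b\<close>. Since \<open>b\<close> is elliptic, \<open>b\<close> and \<open>inv b\<close> lie in the
  same direction, so the word \<open>a b\<close> is cyclically reduced.
\<close>

lemma hyperbolic_mult:
  assumes a: "a \<in> carrier \<Gamma>" "a \<noteq> \<one>" and b: "b \<in> carrier \<Gamma>" "b \<noteq> \<one>" "\<not> hyperbolic b"
    and l: "len (a \<otimes> b) = len a + len b" "len (inv a \<otimes> b) = len a + len b"
  shows "hyperbolic (a \<otimes> b)"
proof -
  let ?p = "a \<otimes> b" and ?q = "inv (a \<otimes> b)"
  have pos: "0 < len a" "0 < len b"
    using a b len_nonneg len_eq_0_iff by (metis order_le_less)+
  have c: "?p \<in> carrier \<Gamma>" "?q \<in> carrier \<Gamma>" "inv b \<in> carrier \<Gamma>" using a b by auto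
  have d: "wdist a b = len a + len b" "wdist a ?p = len b" "wdist (inv b) ?q = len a"
    "wdist (inv b) b = len (b \<otimes> b)" "len (inv b) = len b" "len ?q = len ?p"
    "wdist ?q ?p = len (?p \<otimes> ?p)"
    using a b c l wdist_mult_right[of a b] wdist_mult_right[of "inv b" "inv a"] len_inv
      len_inv[of ?p, unfolded inv_mult_group[OF a(1) b(1)]]
    by (simp_all add: wdist_def inv_mult_group)
  have bb: "len (b \<otimes> b) \<le> len b" using b by (simp add: hyperbolic_def)
  have "len a + len b \<le> wdist a (inv b)"
    using wdist_ultra[of \<one> a "inv b" b] a b c d bb pos by simp
  then have "len a + len ?p \<le> wdist a ?q"
    using wdist_ultra[of \<one> a ?q "inv b"] a b c d pos l
      wdist_commute[of ?q "inv b"] by simp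
  then have "len ?p + len ?p \<le> wdist ?q ?p"
    using wdist_ultra[of \<one> ?q ?p a] a b c d pos l wdist_commute[of ?q a] wdist_commute[of ?p a] by simp
  then show ?thesis using d l pos by (simp add: hyperbolic_def)
qed

text \<open>
  An elliptic element and its inverse share the first half of their geodesics, so that conjugation
  by an element of this half cancels at both ends.
\<close>

lemma len_conj_prefix:
  assumes b: "b \<in> carrier \<Gamma>" "\<not> hyperbolic b" "2 * len q \<le> len b"
    and q: "q \<in> carrier \<Gamma>" "between \<one> q b"
  shows "len (inv q \<otimes> b \<otimes> q) = len b - 2 * len q"
proof -
  have bb: "len (b \<otimes> b) \<le> len b" using b by (simp add: hyperbolic_def)
  have "between \<one> q (inv b)"
    using between_transport[of \<one> q b "inv b"] q b bb len_inv[of b] len_inv[of "b \<otimes> b"]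
      wdist_commute[of b "inv b"] by (simp add: wdist_def)
  then have "len (b \<otimes> q) = len b - len q"
    using b q len_inv[of b] wdist_mult_left[of b q "inv b"]
    by (simp add: between_def wdist_commute[of _ \<one>])
  moreover have "wdist (b \<otimes> q) b = len q"
    using b q wdist_mult_right[of b q] by (simp add: wdist_commute[of "b \<otimes> q"])
  moreover have "wdist q (b \<otimes> q) = len (inv q \<otimes> b \<otimes> q)"
    using q b by (simp add: wdist_def m_assoc)
  moreover have "len b - 2 * len q \<le> len (inv q \<otimes> b \<otimes> q)"
    using len_conj_bounds(1)[of "inv q" b] q b len_inv[of q] by simp
  ultimately show ?thesis
    using wdist_ultra[of \<one> q b "b \<otimes> q"] q b wdist_commute[of b "b \<otimes> q"]
    by (auto simp: between_def)
qed

subsection \<open>The expanding word\<close>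

text \<open>
  The exponents are chosen for \<open>trans_len_pow_mult_conj\<close> and \<open>trans_len_mult_pow\<close>. Both depend only
  on \<open>g\<close>, and \<open>g\<close> itself is the value at the unit.
\<close>

definition spread :: "'a \<Rightarrow> 'a \<Rightarrow> 'a" where
  "spread g x = g \<otimes> (x [^] nat (7 * len g + 3) \<otimes> g \<otimes> x [^] nat (7 * len g + 3) \<otimes> inv g)
     [^] nat (5 * len g + 4)"

text \<open>
  Besides hyperbolic elements \<open>x\<close> there are those for which \<open>x\<^sup>n\<close> is elliptic, treated by the
  assumption \<open>elliptic\<close>, and those for which it is the unit. In the last case the whole inner word
  collapses and only \<open>g\<close> remains.
\<close>

lemma spread_expanding:
  assumes g: "g \<in> carrier \<Gamma>" "hyperbolic g" and x: "x \<in> carrier \<Gamma>"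
    and elliptic: "\<And>z. \<lbrakk>z \<in> carrier \<Gamma>; z \<noteq> \<one>; \<not> hyperbolic z\<rbrakk> \<Longrightarrow> hyperbolic (z \<otimes> (g \<otimes> z \<otimes> inv g))"
  shows "hyperbolic (spread g x)" "hyperbolic x \<Longrightarrow> trans_len x < trans_len (spread g x)"
proof -
  let ?n = "nat (7 * len g + 3)" and ?N = "nat (5 * len g + 4)"
  let ?v = "x [^] ?n \<otimes> g \<otimes> x [^] ?n \<otimes> inv g"
  have L: "0 \<le> len g" using g len_nonneg by simp
  have v: "?v \<in> carrier \<Gamma>" using g x by simp
  have big: "2 * trans_len ?v \<le> trans_len (spread g x)" if hv: "hyperbolic ?v"
  proof -
    have T: "1 \<le> trans_len ?v" using hv by (simp add: hyperbolic_iff)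
    have LT: "len g \<le> len g * trans_len ?v" using mult_left_mono[OF T L] by simp
    have NT: "int ?N * trans_len ?v = 5 * (len g * trans_len ?v) + 4 * trans_len ?v"
      using L by (simp add: algebra_simps)
    show ?thesis
      using trans_len_mult_pow[OF v hv g(1) hyperbolic_not_inverting[OF g v hv], of ?N] NT LT T L
      unfolding spread_def by linarith
  qed
  show "hyperbolic (spread g x)"
  proof (cases "hyperbolic x")
    case True
    then have "hyperbolic ?v"
      using trans_len_pow_mult_conj[OF x _ g refl] by (simp add: hyperbolic_iff)
    then show ?thesis using big by (simp add: hyperbolic_iff)
  next
    case False
    let ?z = "x [^] ?n"
    have z: "?z \<in> carrier \<Gamma>" "\<not> hyperbolic ?z" using x False hyperbolic_pow_imp by auto
    show ?thesis
    proof (cases "?z = \<one>")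
      case True
      then show ?thesis using g by (simp add: spread_def)
    next
      case False
      then have "hyperbolic ?v" using elliptic[OF z(1) False z(2)] z g by (simp add: m_assoc)
      then show ?thesis using big by (simp add: hyperbolic_iff)
    qed
  qed
  show "trans_len x < trans_len (spread g x)" if h: "hyperbolic x"
  proof -
    have "trans_len x \<le> trans_len ?v" by (rule trans_len_pow_mult_conj[OF x h g refl])
    moreover have "0 < trans_len x" using h by (simp add: hyperbolic_iff)
    ultimately show ?thesis using big by (simp add: hyperbolic_iff)
  qed
qed

end

section \<open>The word length on a free product\<close>

locale free_product_groups =
  fixes A :: "'i set" and \<Gamma> :: "'i \<Rightarrow> ('h, 'n) monoid_scheme"
  assumes factor_group: "a \<in> A \<Longrightarrow> group (\<Gamma> a)"
begin

abbreviation F where "F \<equiv> free_product A \<Gamma>"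

lemma reduced_words_append:
  "u @ v \<in> reduced_words A \<Gamma> \<longleftrightarrow> u \<in> reduced_words A \<Gamma> \<and> v \<in> reduced_words A \<Gamma> \<and>
    (u = [] \<or> v = [] \<or> fst (last u) \<noteq> fst (hd v))"
  by (auto simp: reduced_words_def distinct_adj_append_iff last_map hd_map)

lemma foldr_cons_reduce_append:
  "u @ v \<in> reduced_words A \<Gamma> \<Longrightarrow> foldr (cons_reduce \<Gamma>) u v = u @ v"
  by (induction u) (auto simp: reduced_words_Cons)

definition word_inv :: "('i \<times> 'h) list \<Rightarrow> ('i \<times> 'h) list" where
  "word_inv w = rev (map (\<lambda>(a, g). (a, inv\<^bsub>\<Gamma> a\<^esub> g)) w)"

lemma word_inv_simps [simp]:
  "word_inv [] = []" "word_inv ((a, g) # w) = word_inv w @ [(a, inv\<^bsub>\<Gamma> a\<^esub> g)]"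
  "length (word_inv w) = length w" "word_inv w = [] \<longleftrightarrow> w = []"
  by (auto simp: word_inv_def)

lemma fst_last_word_inv: "w \<noteq> [] \<Longrightarrow> fst (last (word_inv w)) = fst (hd w)"
  by (cases w) auto

lemma inv_factor:
  assumes "a \<in> A" "g \<in> carrier (\<Gamma> a)"
  shows "inv\<^bsub>\<Gamma> a\<^esub> g \<in> carrier (\<Gamma> a)" "inv\<^bsub>\<Gamma> a\<^esub> g = \<one>\<^bsub>\<Gamma> a\<^esub> \<longleftrightarrow> g = \<one>\<^bsub>\<Gamma> a\<^esub>"
proof -
  interpret group "\<Gamma> a" using factor_group assms(1) .
  show "inv\<^bsub>\<Gamma> a\<^esub> g \<in> carrier (\<Gamma> a)" "inv\<^bsub>\<Gamma> a\<^esub> g = \<one>\<^bsub>\<Gamma> a\<^esub> \<longleftrightarrow> g = \<one>\<^bsub>\<Gamma> a\<^esub>"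
    using assms(2) by auto
qed

lemma word_inv_reduced: "w \<in> reduced_words A \<Gamma> \<Longrightarrow> word_inv w \<in> reduced_words A \<Gamma>"
proof (induction w)
  case (Cons x w)
  obtain a g where x: "x = (a, g)" by force
  show ?case
    using Cons inv_factor[of a g]
    by (auto simp: x reduced_words_Cons reduced_words_append fst_last_word_inv)
qed simp

lemma foldr_word_inv: "w \<in> reduced_words A \<Gamma> \<Longrightarrow> foldr (cons_reduce \<Gamma>) (word_inv w) w = []"
proof (induction w)
  case (Cons x w)
  obtain a g where x: "x = (a, g)" by force
  have "a \<in> A" "g \<in> carrier (\<Gamma> a)" "w \<in> reduced_words A \<Gamma>" "g \<noteq> \<one>\<^bsub>\<Gamma> a\<^esub>"
    using Cons.prems by (auto simp: x reduced_words_Cons)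
  then show ?case
    using Cons.IH inv_factor[of a g] group.l_inv[OF factor_group, of a g] by (simp add: x)
qed simp

sublocale free_product: group F
  by (rule free_product_group) (rule factor_group)

lemma carrier_F: "carrier F = reduced_words A \<Gamma>"
  and mult_F: "u \<otimes>\<^bsub>F\<^esub> v = foldr (cons_reduce \<Gamma>) u v"
  and one_F: "\<one>\<^bsub>F\<^esub> = []"
  by (simp_all add: free_product_def)

lemma inv_F: "w \<in> reduced_words A \<Gamma> \<Longrightarrow> inv\<^bsub>F\<^esub> w = word_inv w"
  using free_product.inv_equality[of "word_inv w" w] word_inv_reduced foldr_word_inv
  by (simp add: carrier_F mult_F one_F)

text \<open>
  Twice the Gromov product of two reduced words: a common letter counts two, and two different
  letters of the same factor count one, since they merge into a single letter of the quotient.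
\<close>

fun overlap :: "('i \<times> 'h) list \<Rightarrow> ('i \<times> 'h) list \<Rightarrow> int" where
  "overlap ((a, g) # u) ((b, h) # v) =
    (if a \<noteq> b then 0 else if g \<noteq> h then 1 else 2 + overlap u v)"
| "overlap _ _ = 0"

lemma overlap_nonneg: "0 \<le> overlap u v"
  by (induction u v rule: overlap.induct) auto

lemma overlap_ultrametric: "min (overlap u v) (overlap v w) \<le> overlap u w"
proof (induction u w arbitrary: v rule: overlap.induct)
  case (1 a g u b h w)
  show ?case
  proof (cases v)
    case Nil
    then show ?thesis using overlap_nonneg by auto
  next
    case (Cons y v')
    obtain c k where "y = (c, k)" by force
    then show ?thesis
      using 1[of v'] Cons overlap_nonneg[of u v'] overlap_nonneg[of v' w] overlap_nonneg[of u w] by auto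
  qed
qed (use overlap_nonneg in \<open>auto simp: min_le_iff_disj\<close>)

lemma length_word_inv_mult:
  "\<lbrakk>u \<in> reduced_words A \<Gamma>; v \<in> reduced_words A \<Gamma>\<rbrakk> \<Longrightarrow>
    int (length (foldr (cons_reduce \<Gamma>) (word_inv u) v)) = int (length u) + int (length v) - overlap u v"
proof (induction u v rule: overlap.induct)
  case (1 a g u b h v)
  have a: "a \<in> A" "g \<in> carrier (\<Gamma> a)" "g \<noteq> \<one>\<^bsub>\<Gamma> a\<^esub>" "u \<in> reduced_words A \<Gamma>" "u = [] \<or> fst (hd u) \<noteq> a"
    using 1(2) by (auto simp: reduced_words_Cons)
  have b: "b \<in> A" "h \<in> carrier (\<Gamma> b)" "h \<noteq> \<one>\<^bsub>\<Gamma> b\<^esub>" "v \<in> reduced_words A \<Gamma>" "v = [] \<or> fst (hd v) \<noteq> b"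
    using 1(3) by (auto simp: reduced_words_Cons)
  interpret a: group "\<Gamma> a" using factor_group a(1) .
  have i: "inv\<^bsub>\<Gamma> a\<^esub> g \<in> carrier (\<Gamma> a)" "inv\<^bsub>\<Gamma> a\<^esub> g \<noteq> \<one>\<^bsub>\<Gamma> a\<^esub>" using a by auto
  have app: "foldr (cons_reduce \<Gamma>) (word_inv u) ((a, k) # w) = word_inv u @ (a, k) # w"
    if "(a, k) # w \<in> reduced_words A \<Gamma>" for k w
    by (rule foldr_cons_reduce_append)
      (use that a word_inv_reduced[OF a(4)] fst_last_word_inv[of u] in \<open>auto simp: reduced_words_append\<close>)
  show ?case
  proof (cases "a = b")
    case False
    then show ?thesis using app[of "inv\<^bsub>\<Gamma> a\<^esub> g" "(b, h) # v"] a b i by (simp add: reduced_words_Cons)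
  next
    case eq: True
    show ?thesis
    proof (cases "g = h")
      case True
      then show ?thesis using 1(1) eq a b i a.l_inv[OF a(2)] by simp
    next
      case False
      have "inv\<^bsub>\<Gamma> a\<^esub> g \<otimes>\<^bsub>\<Gamma> a\<^esub> h \<noteq> \<one>\<^bsub>\<Gamma> a\<^esub>"
        using False a b eq i by (metis a.inv_equality a.inv_inv)
      then show ?thesis
        using False eq app[of "inv\<^bsub>\<Gamma> a\<^esub> g \<otimes>\<^bsub>\<Gamma> a\<^esub> h" v] a b i
          a.m_closed[of "inv\<^bsub>\<Gamma> a\<^esub> g" h] by (simp add: reduced_words_Cons)
    qed
  qed
next
  case ("2_2" u)
  then show ?case using foldr_cons_reduce_append[of "word_inv u" "[]"] word_inv_reduced[of u]
    by (cases u) auto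
qed auto

abbreviation wlen :: "('i \<times> 'h) list \<Rightarrow> int" where "wlen w \<equiv> int (length w)"

sublocale free_product: lyndon_group F wlen
proof
  fix x y z
  assume "x \<in> carrier F" "y \<in> carrier F" "z \<in> carrier F"
  then show "min (wlen x + wlen y - wlen (inv\<^bsub>F\<^esub> x \<otimes>\<^bsub>F\<^esub> y)) (wlen y + wlen z - wlen (inv\<^bsub>F\<^esub> y \<otimes>\<^bsub>F\<^esub> z))
        \<le> wlen x + wlen z - wlen (inv\<^bsub>F\<^esub> x \<otimes>\<^bsub>F\<^esub> z)"
    using overlap_ultrametric[of x y z]
    by (simp add: carrier_F inv_F mult_F length_word_inv_mult)
next
  fix x k
  assume x: "x \<in> carrier F" and k: "0 \<le> k" "k \<le> wlen x"
  let ?p = "take (nat k) x" and ?q = "drop (nat k) x"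
  have "?p @ ?q \<in> reduced_words A \<Gamma>" using x by (simp add: carrier_F)
  then have pq: "?p \<in> carrier F" "?q \<in> carrier F" "?p \<otimes>\<^bsub>F\<^esub> ?q = x"
    using foldr_cons_reduce_append[of ?p ?q] iffD1[OF reduced_words_append[of ?p ?q]]
    by (simp_all add: carrier_F mult_F)
  then have "inv\<^bsub>F\<^esub> ?p \<otimes>\<^bsub>F\<^esub> x = ?q" using x by (simp add: free_product.inv_solve_left')
  moreover have "wlen ?p = k" "wlen ?q = wlen x - k" using k by auto
  ultimately show "\<exists>p\<in>carrier F. wlen p = k \<and> wlen (inv\<^bsub>F\<^esub> p \<otimes>\<^bsub>F\<^esub> x) = wlen x - k"
    using pq by metis
qed (auto simp: one_F carrier_F inv_F)

lemma overlap_eq: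
  "\<lbrakk>u \<in> carrier F; v \<in> carrier F\<rbrakk> \<Longrightarrow> wlen (inv\<^bsub>F\<^esub> u \<otimes>\<^bsub>F\<^esub> v) = wlen u + wlen v - overlap u v"
  by (simp add: carrier_F inv_F mult_F length_word_inv_mult)

lemma subgroup_free_factor: "a \<in> A \<Longrightarrow> subgroup (free_factor \<Gamma> a) F"
  unfolding free_factor_def
  using group_hom.img_is_subgroup[of "\<Gamma> a" F "factor_incl \<Gamma> a"] factor_incl_hom[of \<Gamma> a A]
    factor_group[of a] free_product.is_group
  by (simp add: group_hom_def group_hom_axioms_def)

lemma mem_free_factor_iff:
  assumes "a \<in> A"
  shows "w \<in> free_factor \<Gamma> a \<longleftrightarrow> w = [] \<or> (\<exists>g. w = [(a, g)] \<and> w \<in> carrier F)"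
proof -
  interpret group "\<Gamma> a" using factor_group assms .
  show ?thesis
    using assms by (auto simp: free_factor_def factor_incl_def carrier_F reduced_words_Cons image_iff)
qed

lemma letter_cases:
  assumes "w \<in> carrier F" "length w = 1"
  obtains a g where "w = [(a, g)]" "a \<in> A" "w \<in> free_factor \<Gamma> a"
  using assms mem_free_factor_iff
  by (cases w) (auto simp: carrier_F reduced_words_Cons)

lemma free_factor_not_hyperbolic:
  assumes "a \<in> A" "w \<in> free_factor \<Gamma> a"
  shows "\<not> free_product.hyperbolic w"
proof -
  have "w \<otimes>\<^bsub>F\<^esub> w \<in> free_factor \<Gamma> a"
    using subgroup.m_closed[OF subgroup_free_factor] assms by blast
  then have "length (w \<otimes>\<^bsub>F\<^esub> w) \<le> 1" "w = [] \<or> length w = 1" "w = [] \<Longrightarrow> w \<otimes>\<^bsub>F\<^esub> w = []"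
    using assms mem_free_factor_iff by (auto simp: mult_F)
  then show ?thesis unfolding free_product.hyperbolic_def by auto
qed

text \<open>
  If \<open>h\<close> is not in the factor of \<open>s\<close>, the letters of \<open>h\<close> beyond that factor survive on both sides of
  the conjugated letter.
\<close>

lemma conj_letter_length_1:
  assumes s: "[(a, s)] \<in> carrier F" and h: "h \<in> carrier F"
    and l: "length (inv\<^bsub>F\<^esub> h \<otimes>\<^bsub>F\<^esub> [(a, s)] \<otimes>\<^bsub>F\<^esub> h) = 1"
  shows "h \<in> free_factor \<Gamma> a"
proof -
  have a: "a \<in> A" "s \<in> carrier (\<Gamma> a)" "s \<noteq> \<one>\<^bsub>\<Gamma> a\<^esub>" using s by (auto simp: carrier_F reduced_words_Cons)
  interpret a: group "\<Gamma> a" using factor_group a(1) .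
  have "wlen (inv\<^bsub>F\<^esub> h \<otimes>\<^bsub>F\<^esub> ([(a, s)] \<otimes>\<^bsub>F\<^esub> h)) = 1"
    using l s h by (simp add: free_product.m_assoc)
  then have *: "wlen h + wlen (cons_reduce \<Gamma> (a, s) h) - overlap h (cons_reduce \<Gamma> (a, s) h) = 1"
    using overlap_eq[of h "[(a, s)] \<otimes>\<^bsub>F\<^esub> h"] free_product.m_closed[OF s h] h
    by (simp add: mult_F)
  show ?thesis
  proof (cases h)
    case Nil
    then show ?thesis using mem_free_factor_iff a by simp
  next
    case (Cons y w)
    obtain b k where y: "y = (b, k)" by force
    have k: "b \<in> A" "k \<in> carrier (\<Gamma> b)" "k \<noteq> \<one>\<^bsub>\<Gamma> b\<^esub>" "w = [] \<or> fst (hd w) \<noteq> b"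
      using h by (auto simp: Cons y carrier_F reduced_words_Cons)
    have ov: "overlap ((b, k) # w) w = 0"
      using k(4) by (cases w) auto
    have ne: "s \<otimes>\<^bsub>\<Gamma> a\<^esub> k \<noteq> k" if "a = b"
      using a k that by (metis a.l_one a.one_closed a.r_cancel)
    have "a = b \<and> w = []"
      using * a ov ne by (auto simp: Cons y split: if_splits)
    then show ?thesis using mem_free_factor_iff a h by (auto simp: Cons y)
  qed
qed

lemma hyperbolic_letter_mult:
  assumes a: "[(i, s)] \<in> carrier F" and b: "b \<in> carrier F" "b \<noteq> []" "fst (hd b) \<noteq> i"
    and nb: "\<not> free_product.hyperbolic b"
  shows "free_product.hyperbolic ([(i, s)] \<otimes>\<^bsub>F\<^esub> b)"
proof (rule free_product.hyperbolic_mult[OF a _ b(1) _ nb])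
  obtain j t b' where "b = (j, t) # b'" using b(2) by (cases b) auto
  then have o: "overlap [(i, k)] b = 0" for k using b(3) by simp
  have i: "[(i, inv\<^bsub>\<Gamma> i\<^esub> s)] \<in> carrier F" "inv\<^bsub>F\<^esub> [(i, s)] = [(i, inv\<^bsub>\<Gamma> i\<^esub> s)]"
    "inv\<^bsub>F\<^esub> [(i, inv\<^bsub>\<Gamma> i\<^esub> s)] = [(i, s)]"
    using a free_product.inv_closed[OF a] free_product.inv_inv[OF a] by (auto simp: inv_F carrier_F)
  show "wlen (inv\<^bsub>F\<^esub> [(i, s)] \<otimes>\<^bsub>F\<^esub> b) = wlen [(i, s)] + wlen b"
    using overlap_eq[OF a b(1)] o by simp
  show "wlen ([(i, s)] \<otimes>\<^bsub>F\<^esub> b) = wlen [(i, s)] + wlen b"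
    using overlap_eq[OF i(1) b(1)] o i(3) by simp
qed (use b in \<open>simp_all add: one_F\<close>)

text \<open>
  In the tree: the product of two elliptic elements with different fixed vertices is hyperbolic.
  If \<open>b\<close> starts with a letter outside the factor \<open>i\<close>, then \<open>hyperbolic_letter_mult\<close> applies.
  Otherwise conjugation by the first letter \<open>q\<close> of \<open>b\<close> keeps \<open>s\<close> in the factor \<open>i\<close> and removes \<open>q\<close>
  from both ends of \<open>b\<close>, and afterwards \<open>b\<close> no longer starts in the factor \<open>i\<close>.
\<close>

lemma elliptic_mult_same_factor:
  assumes a: "[(i, s)] \<in> carrier F" and b: "b \<in> carrier F"
    and nb: "\<not> free_product.hyperbolic b" and nab: "\<not> free_product.hyperbolic ([(i, s)] \<otimes>\<^bsub>F\<^esub> b)"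
  shows "b \<in> free_factor \<Gamma> i"
proof -
  let ?a = "[(i, s)]"
  have i: "i \<in> A" using a by (auto simp: carrier_F reduced_words_Cons)
  have starts: "b' \<noteq> [] \<Longrightarrow> fst (hd b') = i"
    if "b' \<in> carrier F" "\<not> free_product.hyperbolic b'" "[(i, s')] \<in> carrier F"
      "\<not> free_product.hyperbolic ([(i, s')] \<otimes>\<^bsub>F\<^esub> b')" for s' b'
    using hyperbolic_letter_mult that by blast
  show ?thesis
  proof (cases b)
    case Nil
    then show ?thesis using mem_free_factor_iff i by simp
  next
    case (Cons y w)
    then obtain q where q: "b = (i, q) # w" using starts[OF b nb a nab] by (cases y) auto
    let ?q = "[(i, q)]"
    have qc: "?q \<in> carrier F" using b by (simp add: q carrier_F reduced_words_Cons)
    show ?thesis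
    proof (cases "w = []")
      case True
      then show ?thesis using mem_free_factor_iff i b q by simp
    next
      case False
      let ?b = "inv\<^bsub>F\<^esub> ?q \<otimes>\<^bsub>F\<^esub> b \<otimes>\<^bsub>F\<^esub> ?q" and ?a' = "inv\<^bsub>F\<^esub> ?q \<otimes>\<^bsub>F\<^esub> ?a \<otimes>\<^bsub>F\<^esub> ?q"
      have wc: "w \<in> carrier F" "?q \<otimes>\<^bsub>F\<^esub> w = b"
        using b foldr_cons_reduce_append[of ?q w] by (auto simp: q carrier_F mult_F reduced_words_Cons)
      then have "inv\<^bsub>F\<^esub> ?q \<otimes>\<^bsub>F\<^esub> b = w" using qc b by (simp add: free_product.inv_solve_left')
      then have "free_product.between \<one>\<^bsub>F\<^esub> ?q b"
        using b qc by (simp add: free_product.between_def free_product.wdist_def q)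
      then have lb: "wlen ?b = wlen b - 2"
        using free_product.len_conj_prefix[OF b nb _ qc] False by (simp add: q Suc_le_eq)
      have bc: "?b \<in> carrier F" "?a' \<in> carrier F" using qc b a by auto
      have conj: "free_product.hyperbolic (inv\<^bsub>F\<^esub> ?q \<otimes>\<^bsub>F\<^esub> z \<otimes>\<^bsub>F\<^esub> ?q) \<longleftrightarrow> free_product.hyperbolic z"
        if "z \<in> carrier F" for z
        using free_product.hyperbolic_conj[of "inv\<^bsub>F\<^esub> ?q" z] qc that by simp
      have fac: "?a \<in> free_factor \<Gamma> i" "?q \<in> free_factor \<Gamma> i" using mem_free_factor_iff i a qc by auto
      note sub = subgroup_free_factor[OF i]
      have "?a' \<in> free_factor \<Gamma> i"
        by (intro subgroup.m_closed[OF sub] subgroup.m_inv_closed[OF sub] fac)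
      moreover have "?a' \<noteq> []"
      proof
        assume "?a' = []"
        then have "?a = \<one>\<^bsub>F\<^esub>" by (intro free_product.conj_eq_one[OF qc a]) (simp add: one_F)
        then show False by (simp add: one_F)
      qed
      ultimately obtain s' where s': "?a' = [(i, s')]" using mem_free_factor_iff i by auto
      have prod: "?a' \<otimes>\<^bsub>F\<^esub> ?b = inv\<^bsub>F\<^esub> ?q \<otimes>\<^bsub>F\<^esub> (?a \<otimes>\<^bsub>F\<^esub> b) \<otimes>\<^bsub>F\<^esub> ?q"
      proof -
        have "?q \<otimes>\<^bsub>F\<^esub> (inv\<^bsub>F\<^esub> ?q \<otimes>\<^bsub>F\<^esub> (b \<otimes>\<^bsub>F\<^esub> ?q)) = b \<otimes>\<^bsub>F\<^esub> ?q"
          using qc b by (simp flip: free_product.m_assoc)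
        then show ?thesis using qc a b by (simp add: free_product.m_assoc)
      qed
      have "?b \<noteq> []"
      proof
        assume "?b = []"
        then have "b = \<one>\<^bsub>F\<^esub>" by (intro free_product.conj_eq_one[OF qc b]) (simp add: one_F)
        then show False by (simp add: one_F q)
      qed
      moreover have "fst (hd ?b) = i"
        using starts[of ?b s'] bc conj[OF b] nb prod conj[of "?a \<otimes>\<^bsub>F\<^esub> b"] nab a b s' \<open>?b \<noteq> []\<close> by simp
      ultimately obtain t b' where t: "?b = (i, t) # b'" by (cases ?b) auto
      have tb: "[(i, t)] \<in> carrier F" "b' \<in> carrier F" "[(i, t)] \<otimes>\<^bsub>F\<^esub> b' = ?b"
        using bc(1) foldr_cons_reduce_append[of "[(i, t)]" b'] unfolding t
        by (auto simp: carrier_F mult_F reduced_words_Cons)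
      \<comment> \<open>\<open>q\<close> would merge with \<open>t\<close>, so that \<open>b\<close> could not be longer than \<open>?b\<close> by two\<close>
      have "b = ?q \<otimes>\<^bsub>F\<^esub> ?b \<otimes>\<^bsub>F\<^esub> inv\<^bsub>F\<^esub> ?q"
        by (rule free_product.conj_inv_conj[OF qc b, symmetric])
      also have "\<dots> = (?q \<otimes>\<^bsub>F\<^esub> [(i, t)]) \<otimes>\<^bsub>F\<^esub> (b' \<otimes>\<^bsub>F\<^esub> inv\<^bsub>F\<^esub> ?q)"
        using qc tb by (simp add: tb(3)[symmetric] free_product.m_assoc)
      finally have "wlen b \<le> wlen (?q \<otimes>\<^bsub>F\<^esub> [(i, t)]) + (wlen b' + wlen (inv\<^bsub>F\<^esub> ?q))"
        using free_product.len_mult_le[of "?q \<otimes>\<^bsub>F\<^esub> [(i, t)]" "b' \<otimes>\<^bsub>F\<^esub> inv\<^bsub>F\<^esub> ?q"]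
          free_product.len_mult_le[of b' "inv\<^bsub>F\<^esub> ?q"] qc tb by simp
      moreover have "?q \<otimes>\<^bsub>F\<^esub> [(i, t)] \<in> free_factor \<Gamma> i"
        using subgroup.m_closed[OF sub fac(2)] mem_free_factor_iff i tb by auto
      then have "wlen (?q \<otimes>\<^bsub>F\<^esub> [(i, t)]) \<le> 1" using mem_free_factor_iff i by auto
      moreover have "wlen (inv\<^bsub>F\<^esub> ?q) = 1" using free_product.len_inv[OF qc] by simp
      ultimately show ?thesis using lb t by simp
    qed
  qed
qed

lemma free_factor_length:
  "\<lbrakk>a \<in> A; w \<in> free_factor \<Gamma> a\<rbrakk> \<Longrightarrow> w = [] \<or> length w = 1"
  using mem_free_factor_iff by auto

text \<open>
  In the tree: an element that conjugates a non-trivial member of the stabiliser of a vertex into that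
  same stabiliser fixes the vertex, because non-trivial elliptic elements have only one fixed vertex.
\<close>

lemma free_factor_malnormal:
  assumes i: "i \<in> A" and y: "y \<in> free_factor \<Gamma> i" "y \<noteq> []"
    and k: "k \<in> carrier F" "k \<otimes>\<^bsub>F\<^esub> y \<otimes>\<^bsub>F\<^esub> inv\<^bsub>F\<^esub> k \<in> free_factor \<Gamma> i"
  shows "k \<in> free_factor \<Gamma> i"
proof -
  obtain s where s: "y = [(i, s)]" "[(i, s)] \<in> carrier F" using y mem_free_factor_iff[OF i] by auto
  have "k \<otimes>\<^bsub>F\<^esub> y \<otimes>\<^bsub>F\<^esub> inv\<^bsub>F\<^esub> k \<noteq> \<one>\<^bsub>F\<^esub>"
    using free_product.conj_eq_one[of "inv\<^bsub>F\<^esub> k" y] k(1) s y(2) one_F by force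
  then have "length (k \<otimes>\<^bsub>F\<^esub> y \<otimes>\<^bsub>F\<^esub> inv\<^bsub>F\<^esub> k) = 1"
    using free_factor_length[OF i k(2)] unfolding one_F by blast
  then have "inv\<^bsub>F\<^esub> k \<in> free_factor \<Gamma> i"
    using conj_letter_length_1[of i s "inv\<^bsub>F\<^esub> k"] s k by simp
  then show ?thesis
    using subgroup.m_inv_closed[OF subgroup_free_factor[OF i], of "inv\<^bsub>F\<^esub> k"] k(1) by simp
qed

text \<open>
  Otherwise \<open>z\<close> and its conjugate by \<open>h\<close> have the same fixed vertex, and \<open>h\<close> fixes it as well. The proof
  conjugates \<open>z\<close> to a single letter, so that the vertex becomes a factor.
\<close>

lemma elliptic_mult_conj_hyperbolic:
  assumes z: "z \<in> carrier F" "z \<noteq> \<one>\<^bsub>F\<^esub>" "\<not> free_product.hyperbolic z"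
    and h: "h \<in> carrier F" "free_product.hyperbolic h"
  shows "free_product.hyperbolic (z \<otimes>\<^bsub>F\<^esub> (h \<otimes>\<^bsub>F\<^esub> z \<otimes>\<^bsub>F\<^esub> inv\<^bsub>F\<^esub> h))"
proof (rule ccontr)
  let ?y = "h \<otimes>\<^bsub>F\<^esub> z \<otimes>\<^bsub>F\<^esub> inv\<^bsub>F\<^esub> h"
  assume no: "\<not> free_product.hyperbolic (z \<otimes>\<^bsub>F\<^esub> ?y)"
  obtain p where p: "p \<in> carrier F" "wlen (inv\<^bsub>F\<^esub> p \<otimes>\<^bsub>F\<^esub> z \<otimes>\<^bsub>F\<^esub> p) = 1"
    using free_product.not_hyperbolic_conj_letter[OF z] by auto
  define c where "c x = inv\<^bsub>F\<^esub> p \<otimes>\<^bsub>F\<^esub> x \<otimes>\<^bsub>F\<^esub> p" for x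
  interpret c: group_hom F F c
    unfolding c_def by (rule free_product.group_hom_conj[OF p(1)])
  have hyp: "free_product.hyperbolic (c x) \<longleftrightarrow> free_product.hyperbolic x" if "x \<in> carrier F" for x
    using free_product.hyperbolic_conj[of "inv\<^bsub>F\<^esub> p" x] p that by (simp add: c_def)
  obtain i s where s: "c z = [(i, s)]" "i \<in> A" "c z \<in> free_factor \<Gamma> i"
    using letter_cases[of "c z"] p(2) c.hom_closed[OF z(1)] unfolding c_def
    by (metis of_nat_eq_1_iff)
  have y: "?y \<in> carrier F" "\<not> free_product.hyperbolic ?y"
    using z h free_product.hyperbolic_conj by auto
  have "c ?y \<in> free_factor \<Gamma> i"
    using elliptic_mult_same_factor[of i s "c ?y"] s(1) c.hom_closed[OF z(1)] c.hom_closed[OF y(1)]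
      hyp[OF y(1)] y z c.hom_mult[OF z(1) y(1)] hyp[of "z \<otimes>\<^bsub>F\<^esub> ?y"] no
    by simp
  moreover have "c ?y = c h \<otimes>\<^bsub>F\<^esub> c z \<otimes>\<^bsub>F\<^esub> inv\<^bsub>F\<^esub> (c h)" using z h by simp
  ultimately have "c h \<in> free_factor \<Gamma> i"
    using free_factor_malnormal[OF s(2,3)] s(1) h by simp
  then show False using free_factor_not_hyperbolic[OF s(2)] hyp h by auto
qed

end

section \<open>Infinite iterations in a completely metrizable space\<close>

text \<open>
  The sequence \<open>y\<^sub>k\<close> is the value of the infinite composition \<open>f\<^sub>k \<circ> f\<^sub>k\<^sub>+\<^sub>1 \<circ> \<dots>\<close> at \<open>e\<close>. To make all these
  compositions converge, \<open>f\<^sub>m\<close> is chosen with \<open>f\<^sub>m(e)\<close> so close to \<open>e\<close> that inserting \<open>f\<^sub>m\<close> as the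
  last map moves each of the finitely many compositions \<open>f\<^sub>k \<circ> \<dots> \<circ> f\<^sub>m\<^sub>-\<^sub>1\<close> with \<open>k \<le> m\<close> by
  less than \<open>2\<^sup>-\<^sup>m\<close> at \<open>e\<close>. Only the value of \<open>f\<^sub>m\<close> at \<open>e\<close> is constrained, so the maps may be as wild as desired
  elsewhere.
\<close>

lemma infinite_iteration:
  assumes T: "completely_metrizable_space T" and e: "e \<in> topspace T"
    and cont: "\<And>f. f \<in> \<W> \<Longrightarrow> continuous_map T T f"
    and small: "\<And>U. \<lbrakk>openin T U; e \<in> U\<rbrakk> \<Longrightarrow> \<exists>f\<in>\<W>. f e \<in> U"
  shows "\<exists>f y. \<forall>k::nat. f k \<in> \<W> \<and> y k \<in> topspace T \<and> y k = f k (y (Suc k))"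
proof -
  obtain M d where "Metric_space M d" and compl: "Metric_space.mcomplete M d"
    and Teq: "T = Metric_space.mtopology M d"
    using T by (auto simp: completely_metrizable_space_def)
  interpret Metric_space M d by fact
  have top: "topspace T = M" by (simp add: Teq)
  define iter where "iter f k m = foldr (\<lambda>i g. f i \<circ> g) [k..<m] id" for f :: "nat \<Rightarrow> 'a \<Rightarrow> 'a" and k m
  have foldr_comp: "foldr (\<lambda>i g. f i \<circ> g) ks h = foldr (\<lambda>i g. f i \<circ> g) ks id \<circ> h"
    for f :: "nat \<Rightarrow> 'a \<Rightarrow> 'a" and ks h
    by (induction ks) (auto simp: comp_assoc)
  have iter_last: "iter f k (Suc m) = iter f k m \<circ> f m" if "k \<le> m" for f k m
    using that foldr_comp[of f "[k..<m]" "f m"] by (simp add: iter_def)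
  have iter_first: "iter f k m = f k \<circ> iter f (Suc k) m" if "k < m" for f k m
    using that by (simp add: iter_def upt_conv_Cons)
  have iter_cong: "iter f k m = iter g k m" if "\<And>i. i < m \<Longrightarrow> f i = g i" for f g k m
    unfolding iter_def by (rule foldr_cong) (use that in auto)
  have iter_cont: "continuous_map T T (iter f k m)" if "\<And>i. i < m \<Longrightarrow> f i \<in> \<W>" for f k m
    using that
  proof (induction m)
    case (Suc m)
    show ?case
    proof (cases "k \<le> m")
      case True
      have "continuous_map T T (iter f k m \<circ> f m)"
        by (rule continuous_map_compose[OF cont Suc.IH]) (use Suc.prems in auto)
      then show ?thesis by (simp only: iter_last[OF True])
    qed (simp add: iter_def id_def)
  qed (simp add: iter_def id_def)
  define P where "P f m g \<longleftrightarrow> g \<in> \<W> \<and> (\<forall>k\<le>m. d (iter f k m (g e)) (iter f k m e) < (1/2) ^ m)" for f m g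
  have "\<exists>f. \<forall>m. P f m (f m)"
  proof (rule dependent_wellorder_choice)
    fix g :: "'a \<Rightarrow> 'a" and f f' :: "nat \<Rightarrow> 'a \<Rightarrow> 'a" and m
    assume "\<And>y. y < m \<Longrightarrow> f y = f' y"
    then show "P f m g = P f' m g" unfolding P_def using iter_cong[of m f f'] by simp
  next
    fix m and f :: "nat \<Rightarrow> 'a \<Rightarrow> 'a"
    assume "\<And>i. i < m \<Longrightarrow> P f i (f i)"
    then have f: "\<And>i. i < m \<Longrightarrow> f i \<in> \<W>" by (simp add: P_def)
    have cm: "continuous_map T T (iter f k m)" for k by (rule iter_cont) (rule f)
    define U where "U k = {x \<in> topspace T. iter f k m x \<in> mball (iter f k m e) ((1/2) ^ m)}" for k
    have "openin T (U k)" for k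
      unfolding U_def by (rule openin_continuous_map_preimage[OF cm]) (auto simp: Teq)
    then have "openin T (\<Inter>k\<le>m. U k)" by auto
    moreover have "e \<in> U k" for k
      using e continuous_map_funspace[OF cm[of k]] by (auto simp: U_def top Pi_iff)
    ultimately obtain g where "g \<in> \<W>" "g e \<in> (\<Inter>k\<le>m. U k)" using small[of "\<Inter>k\<le>m. U k"] by auto
    then show "\<exists>g. P f m g" unfolding P_def U_def by (auto simp: commute)
  qed
  then obtain f where f: "\<And>m. f m \<in> \<W>"
    and near: "\<And>k m. k \<le> m \<Longrightarrow> d (iter f k m (f m e)) (iter f k m e) < (1/2) ^ m"
    by (auto simp: P_def)
  define s where "s k j = iter f k (k + j) e" for k j
  have sM: "s k j \<in> M" for k j
    using continuous_map_funspace[OF iter_cont[of "k + j" f k]] f e by (auto simp: s_def top Pi_iff)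
  have step: "d (s k (Suc j)) (s k j) < (1/2) ^ j" for k j
  proof -
    have "d (s k (Suc j)) (s k j) < (1/2) ^ (k + j)"
      using near[of k "k + j"] by (simp add: s_def iter_last)
    also have "\<dots> \<le> (1/2) ^ j" by (rule power_decreasing) auto
    finally show ?thesis .
  qed
  have tail: "d (s k j) (s k (j + i)) \<le> 2 * (1/2) ^ j * (1 - (1/2) ^ i)" for k j i
  proof (induction i)
    case (Suc i)
    have "d (s k j) (s k (j + Suc i)) \<le> d (s k j) (s k (j + i)) + d (s k (j + i)) (s k (j + Suc i))"
      by (rule triangle) (auto simp: sM)
    also have "\<dots> \<le> 2 * (1/2) ^ j * (1 - (1/2) ^ i) + (1/2) ^ (j + i)"
      using Suc step[of k "j + i"] by (simp add: commute)
    finally show ?case by (simp add: power_add algebra_simps)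
  qed (simp add: sM)
  have tail': "d (s k j) (s k (j + i)) \<le> 2 * (1/2) ^ j" for k j i
  proof -
    have "2 * (1/2) ^ j * (1 - (1/2) ^ i) \<le> 2 * (1/2::real) ^ j * 1"
      by (rule mult_left_mono) auto
    then show ?thesis using tail[of k j i] by linarith
  qed
  have "MCauchy (s k)" for k
    unfolding MCauchy_def
  proof (intro conjI allI impI)
    fix \<epsilon> :: real assume "\<epsilon> > 0"
    then obtain N where N: "(1/2) ^ N < \<epsilon> / 4" using real_arch_pow_inv[of "\<epsilon>/4" "1/2"] by auto
    have "d (s k n) (s k n') < \<epsilon>" if "N \<le> n" "N \<le> n'" for n n'
      using tail'[of k N "n - N"] tail'[of k N "n' - N"] that N
        triangle[of "s k n" "s k N" "s k n'"] commute[of "s k n" "s k N"] sM by simp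
    then show "\<exists>N. \<forall>n n'. N \<le> n \<longrightarrow> N \<le> n' \<longrightarrow> d (s k n) (s k n') < \<epsilon>" by blast
  qed (use sM in auto)
  then have "\<exists>x. limitin T (s k) x sequentially" for k
    using compl by (simp add: mcomplete_def Teq)
  then obtain y where y: "\<And>k. limitin T (s k) (y k) sequentially" by metis
  have "y k = f k (y (Suc k))" for k
  proof -
    have "s k (j + 1) = f k (s (Suc k) j)" for j by (simp add: s_def iter_first)
    then have "limitin T (\<lambda>j. s k (j + 1)) (f k (y (Suc k))) sequentially"
      using continuous_map_limit[OF cont[OF f, of k] y[of "Suc k"]] by (simp add: o_def)
    moreover have "limitin T (\<lambda>j. s k (j + 1)) (y k) sequentially"
      by (rule limitin_sequentially_offset[OF y])
    ultimately show ?thesis using limitin_metric_unique[of _ "y k" sequentially] by (simp add: Teq)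
  qed
  moreover have "y k \<in> topspace T" for k using y by (simp add: limitin_def)
  ultimately show ?thesis using f by blast
qed

section \<open>Homomorphisms into a free product\<close>

context topological_group begin

lemma continuous_map_group_mult:
  assumes "continuous_map Z T f" "continuous_map Z T g"
  shows "continuous_map Z T (\<lambda>x. f x \<otimes> g x)"
  using continuous_map_compose[OF continuous_map_pairedI[OF assms] continuous_mult]
  by (simp add: o_def)

lemma continuous_map_group_pow:
  assumes f: "continuous_map Z T f"
  shows "continuous_map Z T (\<lambda>x. f x [^] (n::nat))"
proof (induction n)
  case (Suc n)
  then show ?case using continuous_map_group_mult[OF Suc f] by simp
qed (use topspace_eq_carrier in \<open>simp add: continuous_map_const\<close>)

lemma openin_preimage:
  assumes "continuous_map T T f" "openin T U"
  shows "openin T {x \<in> carrier G. f x \<in> U}"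
  using openin_continuous_map_preimage[OF assms] by (simp add: topspace_eq_carrier)

lemma exists_open_square_subset:
  assumes "openin T U" "\<one> \<in> U"
  shows "\<exists>V. openin T V \<and> \<one> \<in> V \<and> (\<forall>x\<in>V. \<forall>y\<in>V. x \<otimes> y \<in> U)"
proof -
  let ?P = "{z \<in> topspace (prod_topology T T). (\<lambda>(x, y). x \<otimes> y) z \<in> U}"
  have "openin (prod_topology T T) ?P"
    using openin_continuous_map_preimage[OF continuous_mult assms(1)] .
  moreover have "(\<one>, \<one>) \<in> ?P" using assms by (simp add: topspace_eq_carrier)
  ultimately obtain A B where AB: "openin T A" "openin T B" "\<one> \<in> A" "\<one> \<in> B" "A \<times> B \<subseteq> ?P"
    using openin_prod_topology_alt[of T T ?P] by blast
  show ?thesis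
  proof (intro exI conjI ballI)
    show "openin T (A \<inter> B)" "\<one> \<in> A \<inter> B" using AB by (auto intro: openin_Int)
    show "x \<otimes> y \<in> U" if "x \<in> A \<inter> B" "y \<in> A \<inter> B" for x y
      using subsetD[OF AB(5), of "(x, y)"] that by simp
  qed
qed

lemma continuous_map_discrete_if_trivial_nbhd:
  assumes H: "group H" and \<phi>: "\<phi> \<in> hom G H"
    and U: "openin T U" "\<one> \<in> U" "\<And>x. x \<in> U \<Longrightarrow> \<phi> x = \<one>\<^bsub>H\<^esub>"
  shows "continuous_map T (discrete_topology (carrier H)) \<phi>"
proof -
  interpret group_hom G H \<phi>
    using H \<phi> is_group by (simp add: group_hom_def group_hom_axioms_def)
  have "openin T {x \<in> carrier G. \<phi> x \<in> S}" for S
  proof (subst openin_subopen, intro ballI)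
    fix x assume x: "x \<in> {x \<in> carrier G. \<phi> x \<in> S}"
    have "continuous_map T T (\<lambda>y. inv x \<otimes> y)"
      using x by (intro continuous_map_group_mult) (auto simp: topspace_eq_carrier continuous_map_const)
    then have op: "openin T {y \<in> carrier G. inv x \<otimes> y \<in> U}"
      using openin_preimage U(1) by blast
    have same: "\<phi> y = \<phi> x" if "y \<in> carrier G" "inv x \<otimes> y \<in> U" for y
    proof -
      have "inv\<^bsub>H\<^esub> (\<phi> x) \<otimes>\<^bsub>H\<^esub> \<phi> y = \<one>\<^bsub>H\<^esub>"
        using U(3)[OF that(2)] that x by simp
      then have "\<phi> x \<otimes>\<^bsub>H\<^esub> (inv\<^bsub>H\<^esub> (\<phi> x) \<otimes>\<^bsub>H\<^esub> \<phi> y) = \<phi> x" using x by simp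
      then show ?thesis using that x by (simp flip: H.m_assoc)
    qed
    have "{y \<in> carrier G. inv x \<otimes> y \<in> U} \<subseteq> {x \<in> carrier G. \<phi> x \<in> S}"
    proof
      fix y assume "y \<in> {y \<in> carrier G. inv x \<otimes> y \<in> U}"
      then show "y \<in> {x \<in> carrier G. \<phi> x \<in> S}" using same[of y] x by simp
    qed
    moreover have "x \<in> {y \<in> carrier G. inv x \<otimes> y \<in> U}" using x U(2) by simp
    ultimately show "\<exists>V. openin T V \<and> x \<in> V \<and> V \<subseteq> {x \<in> carrier G. \<phi> x \<in> S}"
      using op by blast
  qed
  then show ?thesis by (auto simp: continuous_map_def topspace_eq_carrier)
qed

end

text \<open>
  If there were arbitrarily small elements with hyperbolic images, the maps \<open>spread g\<close>, lifted to \<open>G\<close>,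
  would form a class to which \<open>infinite_iteration\<close> applies at the unit. Along the resulting sequence the
  translation length is a strictly decreasing sequence of positive integers.
\<close>

lemma (in free_product_groups) elliptic_nbhd:
  assumes G: "topological_group G T" and compl: "completely_metrizable_space T"
    and \<phi>: "\<phi> \<in> hom G F"
  shows "\<exists>U. openin T U \<and> \<one>\<^bsub>G\<^esub> \<in> U \<and> (\<forall>x\<in>U. \<not> free_product.hyperbolic (\<phi> x))"
proof (rule ccontr)
  assume no: "\<not> ?thesis"
  interpret G: topological_group G T by fact
  interpret \<phi>: group_hom G F \<phi>
    using \<phi> G.is_group free_product.is_group by (simp add: group_hom_def group_hom_axioms_def)
  define \<W> where "\<W> = {f. continuous_map T T f \<and> (\<forall>x\<in>carrier G. free_product.hyperbolic (\<phi> (f x)) \<and>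
     (free_product.hyperbolic (\<phi> x) \<longrightarrow> free_product.trans_len (\<phi> x) < free_product.trans_len (\<phi> (f x))))}"
  have "\<exists>f\<in>\<W>. f \<one>\<^bsub>G\<^esub> \<in> U" if U: "openin T U" "\<one>\<^bsub>G\<^esub> \<in> U" for U
  proof -
    obtain g where g: "g \<in> U" "free_product.hyperbolic (\<phi> g)" using no U by blast
    have gG: "g \<in> carrier G" using openin_subset[OF U(1)] g by (auto simp: G.topspace_eq_carrier)
    define n N where "n = nat (7 * wlen (\<phi> g) + 3)" and "N = nat (5 * wlen (\<phi> g) + 4)"
    define f where "f x = g \<otimes>\<^bsub>G\<^esub> (x [^]\<^bsub>G\<^esub> n \<otimes>\<^bsub>G\<^esub> g \<otimes>\<^bsub>G\<^esub> x [^]\<^bsub>G\<^esub> n \<otimes>\<^bsub>G\<^esub> inv\<^bsub>G\<^esub> g) [^]\<^bsub>G\<^esub> N" for x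
    have "continuous_map T T f"
      unfolding f_def
      by (intro G.continuous_map_group_mult G.continuous_map_group_pow continuous_map_id[unfolded id_def])
        (use gG in \<open>auto simp: G.topspace_eq_carrier continuous_map_const\<close>)
    moreover have "\<phi> (f x) = free_product.spread (\<phi> g) (\<phi> x)" if "x \<in> carrier G" for x
      unfolding f_def free_product.spread_def n_def[symmetric] N_def[symmetric]
      using that gG by (simp add: \<phi>.hom_nat_pow)
    ultimately have "f \<in> \<W>"
      unfolding \<W>_def
      using free_product.spread_expanding[OF _ g(2)] elliptic_mult_conj_hyperbolic[OF _ _ _ _ g(2)] gG
      by auto
    moreover have "f \<one>\<^bsub>G\<^esub> = g" using gG by (simp add: f_def)
    ultimately show ?thesis using g by auto
  qed
  then obtain f y where fy: "\<And>k::nat. f k \<in> \<W>" "\<And>k. y k \<in> carrier G" "\<And>k. y k = f k (y (Suc k))"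
  proof -
    have "\<exists>f y. \<forall>k::nat. f k \<in> \<W> \<and> y k \<in> topspace T \<and> y k = f k (y (Suc k))"
    proof (rule infinite_iteration[OF compl])
      show "\<one>\<^bsub>G\<^esub> \<in> topspace T" by (simp add: G.topspace_eq_carrier)
      show "continuous_map T T f" if "f \<in> \<W>" for f using that by (simp add: \<W>_def)
    qed fact
    then show thesis using that unfolding G.topspace_eq_carrier by blast
  qed
  have hyp: "free_product.hyperbolic (\<phi> (y k))" for k
    using fy(1)[of k] fy(2)[of "Suc k"] fy(3)[of k] by (simp add: \<W>_def)
  have step: "free_product.trans_len (\<phi> (y (Suc k))) < free_product.trans_len (\<phi> (y k))" for k
    using fy(1)[of k] fy(2)[of "Suc k"] fy(3)[of k] hyp[of "Suc k"] by (simp add: \<W>_def)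
  have "free_product.trans_len (\<phi> (y k)) + int k \<le> free_product.trans_len (\<phi> (y 0))" for k
  proof (induction k)
    case (Suc k)
    then show ?case using step[of k] by simp
  qed simp
  from this[of "nat (free_product.trans_len (\<phi> (y 0)))"] hyp show False
    using free_product.hyperbolic_iff by (smt (verit) int_nat_eq)
qed

theorem theorem1p5:
  fixes G :: "('g, 'm) monoid_scheme"
    and T :: "'g topology"
    and A :: "'i set"
    and \<Gamma> :: "'i \<Rightarrow> ('h, 'n) monoid_scheme"
    and \<phi> :: "'g \<Rightarrow> ('i \<times> 'h) list"
  assumes "topological_group G T"
    and "completely_metrizable_space T"
    and "\<And>a. a \<in> A \<Longrightarrow> group (\<Gamma> a)"
    and "\<And>a. a \<in> A \<Longrightarrow> carrier (\<Gamma> a) \<noteq> {\<one>\<^bsub>\<Gamma> a\<^esub>}"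
    and "\<phi> \<in> hom G (free_product A \<Gamma>)"
  shows "continuous_map T (discrete_topology (carrier (free_product A \<Gamma>))) \<phi> \<or>
    (\<exists>a\<in>A. \<exists>\<gamma>\<in>carrier (free_product A \<Gamma>).
      \<phi> ` carrier G \<subseteq>
        (\<gamma> <#\<^bsub>free_product A \<Gamma>\<^esub> free_factor \<Gamma> a) #>\<^bsub>free_product A \<Gamma>\<^esub> (inv\<^bsub>free_product A \<Gamma>\<^esub> \<gamma>))"
proof (cases "continuous_map T (discrete_topology (carrier (free_product A \<Gamma>))) \<phi>")
  case False
  interpret G: topological_group G T by fact
  interpret free_product_groups A \<Gamma> by (rule free_product_groups.intro) (rule assms(3))
  interpret \<phi>: group_hom G F \<phi>
    using assms(5) G.is_group free_product.is_group by (simp add: group_hom_def group_hom_axioms_def)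
  have nontrivial: "\<exists>v\<in>V. \<phi> v \<noteq> []" if "openin T V" "\<one>\<^bsub>G\<^esub> \<in> V" for V
    using G.continuous_map_discrete_if_trivial_nbhd[OF free_product.is_group assms(5) that] False
    by (auto simp: one_F)
  obtain U where U: "openin T U" "\<one>\<^bsub>G\<^esub> \<in> U" "\<And>x. x \<in> U \<Longrightarrow> \<not> free_product.hyperbolic (\<phi> x)"
    using elliptic_nbhd[OF assms(1,2,5)] by blast
  obtain V where V: "openin T V" "\<one>\<^bsub>G\<^esub> \<in> V" "\<And>x y. \<lbrakk>x \<in> V; y \<in> V\<rbrakk> \<Longrightarrow> x \<otimes>\<^bsub>G\<^esub> y \<in> U"
    using G.exists_open_square_subset[OF U(1,2)] by blast
  have VG: "V \<subseteq> carrier G" using openin_subset[OF V(1)] by (simp add: G.topspace_eq_carrier)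
  have VU: "V \<subseteq> U" using V(3)[OF V(2)] VG by (metis G.l_one subsetD subsetI)
  obtain v\<^sub>0 where v\<^sub>0: "v\<^sub>0 \<in> V" "\<phi> v\<^sub>0 \<noteq> []" using nontrivial[OF V(1,2)] by blast
  have v\<^sub>0G: "v\<^sub>0 \<in> carrier G" using v\<^sub>0 VG by blast
  obtain p where p: "p \<in> carrier F" "wlen (inv\<^bsub>F\<^esub> p \<otimes>\<^bsub>F\<^esub> \<phi> v\<^sub>0 \<otimes>\<^bsub>F\<^esub> p) = 1"
    using free_product.not_hyperbolic_conj_letter[of "\<phi> v\<^sub>0"] v\<^sub>0 v\<^sub>0G U(3) VU by (auto simp: one_F)
  \<comment> \<open>\<open>c\<close> moves the vertex fixed by the image of \<open>v\<^sub>0\<close> to a factor, the one with index \<open>i\<close>\<close>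
  define c where "c x = inv\<^bsub>F\<^esub> p \<otimes>\<^bsub>F\<^esub> x \<otimes>\<^bsub>F\<^esub> p" for x
  interpret c: group_hom F F c
    unfolding c_def by (rule free_product.group_hom_conj[OF p(1)])
  have hyp: "free_product.hyperbolic (c x) \<longleftrightarrow> free_product.hyperbolic x" if "x \<in> carrier F" for x
    using free_product.hyperbolic_conj[of "inv\<^bsub>F\<^esub> p" x] p that by (simp add: c_def)
  obtain i s where s: "c (\<phi> v\<^sub>0) = [(i, s)]" "i \<in> A"
    using letter_cases[of "c (\<phi> v\<^sub>0)"] p(2) c.hom_closed[OF \<phi>.hom_closed[OF v\<^sub>0G]] unfolding c_def
    by (metis of_nat_eq_1_iff)
  have inV: "c (\<phi> v) \<in> free_factor \<Gamma> i" if v: "v \<in> V" for v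
  proof (rule elliptic_mult_same_factor)
    have vG: "v \<in> carrier G" using v VG by blast
    show "[(i, s)] \<in> carrier F" using c.hom_closed[OF \<phi>.hom_closed[OF v\<^sub>0G]] s by simp
    show "c (\<phi> v) \<in> carrier F" using vG by simp
    show "\<not> free_product.hyperbolic (c (\<phi> v))" using hyp U(3) v VU vG by auto
    have "[(i, s)] \<otimes>\<^bsub>F\<^esub> c (\<phi> v) = c (\<phi> (v\<^sub>0 \<otimes>\<^bsub>G\<^esub> v))" using v\<^sub>0G vG s(1) by simp
    then show "\<not> free_product.hyperbolic ([(i, s)] \<otimes>\<^bsub>F\<^esub> c (\<phi> v))"
      using hyp[of "\<phi> (v\<^sub>0 \<otimes>\<^bsub>G\<^esub> v)"] U(3)[OF V(3)[OF v\<^sub>0(1) v]] v\<^sub>0G vG by simp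
  qed
  have all: "c (\<phi> x) \<in> free_factor \<Gamma> i" if x: "x \<in> carrier G" for x
  proof -
    \<comment> \<open>some \<open>v\<close> outside the kernel and its conjugate by \<open>x\<close> both lie in \<open>V\<close>\<close>
    let ?V = "V \<inter> {v \<in> carrier G. x \<otimes>\<^bsub>G\<^esub> v \<otimes>\<^bsub>G\<^esub> inv\<^bsub>G\<^esub> x \<in> V}"
    have "continuous_map T T (\<lambda>v. x \<otimes>\<^bsub>G\<^esub> v \<otimes>\<^bsub>G\<^esub> inv\<^bsub>G\<^esub> x)"
      by (intro G.continuous_map_group_mult continuous_map_id[unfolded id_def])
        (use x in \<open>auto simp: G.topspace_eq_carrier continuous_map_const\<close>)
    then have "openin T ?V" using G.openin_preimage V(1) by blast
    moreover have "\<one>\<^bsub>G\<^esub> \<in> ?V" using V(2) x by simp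
    ultimately obtain v where v: "v \<in> ?V" "\<phi> v \<noteq> []" using nontrivial by blast
    have ne: "c (\<phi> v) \<noteq> []"
      using free_product.conj_eq_one[OF p(1), of "\<phi> v"] v by (auto simp: c_def one_F)
    have conj: "c (\<phi> x) \<otimes>\<^bsub>F\<^esub> c (\<phi> v) \<otimes>\<^bsub>F\<^esub> inv\<^bsub>F\<^esub> c (\<phi> x) \<in> free_factor \<Gamma> i"
      using inV[of "x \<otimes>\<^bsub>G\<^esub> v \<otimes>\<^bsub>G\<^esub> inv\<^bsub>G\<^esub> x"] v x by simp
    have "c (\<phi> x) \<in> carrier F" by (rule c.hom_closed[OF \<phi>.hom_closed[OF x]])
    with free_factor_malnormal[OF s(2) inV ne _ conj] v(1) show ?thesis by blast
  qed
  have "\<phi> ` carrier G \<subseteq> (p <#\<^bsub>F\<^esub> free_factor \<Gamma> i) #>\<^bsub>F\<^esub> inv\<^bsub>F\<^esub> p"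
  proof (rule image_subsetI)
    fix x assume x: "x \<in> carrier G"
    have "\<phi> x = p \<otimes>\<^bsub>F\<^esub> c (\<phi> x) \<otimes>\<^bsub>F\<^esub> inv\<^bsub>F\<^esub> p"
      unfolding c_def by (rule free_product.conj_inv_conj[OF p(1) \<phi>.hom_closed[OF x], symmetric])
    then show "\<phi> x \<in> (p <#\<^bsub>F\<^esub> free_factor \<Gamma> i) #>\<^bsub>F\<^esub> inv\<^bsub>F\<^esub> p"
      using all[OF x] unfolding l_coset_def r_coset_def by blast
  qed
  then show ?thesis using s(2) p(1) by blast
qed simp

end
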